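(* Let $K$ be a field and let $\mathcal{G}$ be an ample Hausdorff groupoid satisfying the condition: for every $x\in\mathcal{G}^{(0)}$, $\mathrm{soc}(A_K(x\mathcal{G}x))\neq 0$ if and only if $x\mathcal{G}x=\{x\}$. Then the left socle of the algebra $A_K(\mathcal{G})$ is the two-sided ideal $$\mathrm{soc}(A_K(\mathcal{G}))=\left(1_{\{x\}} : \{x\}\subset\mathcal{G}^{(0)}\text{ is open and } x\mathcal{G}x=\{x\}\right).$$ Moreover, if $x\in\mathcal{G}^{(0)}$ with $\{x\}$ open and $I_x=A_K(\mathcal{G})1_{\{x\}}$ is a minimal left ideal, then its corresponding homogeneous component is $$M=\sum_{I\cong I_x}I=(1_{\{x\}}),$$ where the sum runs over all left ideals $I$ of $A_K(\mathcal{G})$ isomorphic to $I_x$ as left $A_K(\mathcal{G})$-modules.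
   Context: For a groupoid $\mathcal{G}$, $r(\gamma)=\gamma\gamma^{-1}$, $s(\gamma)=\gamma^{-1}\gamma$, and $\mathcal{G}^{(0)}$ is the unit space; $x\mathcal{G}x=\{\gamma\in\mathcal{G}: r(\gamma)=s(\gamma)=x\}$ is the isotropy group at a unit $x$. An open bisection of a topological groupoid is an open set $B\subset\mathcal{G}$ such that $r|_B$ and $s|_B$ are homeomorphisms onto open subsets of $\mathcal{G}^{(0)}$. A topological groupoid is ample if its topology has a basis of compact open bisections (it is then étale, and $\mathcal{G}^{(0)}$ is open in $\mathcal{G}$). For an ample Hausdorff groupoid $\mathcal{G}$ and a field $K$, the Steinberg algebra $A_K(\mathcal{G})$ is the $K$-algebra of all locally constant functions $f:\mathcal{G}\to K$ with compact support $\{\gamma: f(\gamma)\neq 0\}$, with pointwise linear structure and convolution $(fg)(\gamma)=\sum_{\alpha\beta=\gamma}f(\alpha)g(\beta)$; $1_B$ denotes the characteristic function of $B$. $A_K(x\mathcal{G}x)$ is the Steinberg algebra of the (discrete) isotropy group $x\mathcal{G}x$, i.e. its group algebra over $K$. The socle $\mathrm{soc}(A)$ of an algebra $A$ means the left socle: the sum of all minimal left ideals of $A$ (and $0$ if there are none), where a minimal left ideal is a nonzero left ideal containing no left ideals other than $0$ and itself. $(S)$ denotes the two-sided ideal generated by a set $S$. *)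

theory Defs
  imports
    "HOL-Analysis.Abstract_Topology"
    "HOL-Analysis.Product_Topology"
    "HOL-Analysis.T1_Spaces"
    "HOL-Library.Function_Algebras"
    "HOL-Library.Indicator_Function"
begin

section \<open>Topological groupoids\<close>

text \<open>The underlying set is the space of the topology; \<open>comp_pairs\<close> is the set of
  composable pairs. Values of \<open>gmult\<close> and \<open>ginv\<close> outside their domains are irrelevant.\<close>

record 'g groupoid_data =
  gtop :: "'g topology"
  comp_pairs :: "('g \<times> 'g) set"
  gmult :: "'g \<Rightarrow> 'g \<Rightarrow> 'g"
  ginv :: "'g \<Rightarrow> 'g"

abbreviation gcarrier :: "'g groupoid_data \<Rightarrow> 'g set" where
  "gcarrier G \<equiv> topspace (gtop G)"

text \<open>Renault's axioms. Applying the condition on \<open>(ginv G a, a)\<close> to \<open>ginv G a\<close> shows that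
  \<open>(a, ginv G a)\<close> is composable as well; that \<open>(a, b)\<close> is composable iff the source of \<open>a\<close>
  is the range of \<open>b\<close> is a consequence.\<close>

definition groupoid :: "'g groupoid_data \<Rightarrow> bool" where
  "groupoid G \<longleftrightarrow>
     comp_pairs G \<subseteq> gcarrier G \<times> gcarrier G \<and>
     (\<forall>a b. (a, b) \<in> comp_pairs G \<longrightarrow> gmult G a b \<in> gcarrier G) \<and>
     (\<forall>a \<in> gcarrier G. ginv G a \<in> gcarrier G \<and> ginv G (ginv G a) = a \<and>
        (ginv G a, a) \<in> comp_pairs G) \<and>
     (\<forall>a b c. (a, b) \<in> comp_pairs G \<and> (b, c) \<in> comp_pairs G \<longrightarrow>
        (gmult G a b, c) \<in> comp_pairs G \<and> (a, gmult G b c) \<in> comp_pairs G \<and>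
        gmult G (gmult G a b) c = gmult G a (gmult G b c)) \<and>
     (\<forall>a b. (a, b) \<in> comp_pairs G \<longrightarrow>
        gmult G (ginv G a) (gmult G a b) = b \<and> gmult G (gmult G a b) (ginv G b) = a)"

definition topological_groupoid :: "'g groupoid_data \<Rightarrow> bool" where
  "topological_groupoid G \<longleftrightarrow> groupoid G \<and>
     continuous_map (subtopology (prod_topology (gtop G) (gtop G)) (comp_pairs G)) (gtop G)
       (\<lambda>(a, b). gmult G a b) \<and>
     continuous_map (gtop G) (gtop G) (ginv G)"

definition grange :: "'g groupoid_data \<Rightarrow> 'g \<Rightarrow> 'g" where
  "grange G a = gmult G a (ginv G a)"

definition gsource :: "'g groupoid_data \<Rightarrow> 'g \<Rightarrow> 'g" where
  "gsource G a = gmult G (ginv G a) a"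

definition unit_space :: "'g groupoid_data \<Rightarrow> 'g set" where
  "unit_space G = grange G ` gcarrier G"

definition isotropy :: "'g groupoid_data \<Rightarrow> 'g \<Rightarrow> 'g set" where
  "isotropy G x = {a \<in> gcarrier G. grange G a = x \<and> gsource G a = x}"

definition isotropy_group :: "'g groupoid_data \<Rightarrow> 'g \<Rightarrow> 'g groupoid_data" where
  "isotropy_group G x =
     \<lparr> gtop = discrete_topology (isotropy G x),
       comp_pairs = isotropy G x \<times> isotropy G x,
       gmult = gmult G,
       ginv = ginv G \<rparr>"

definition open_bisection :: "'g groupoid_data \<Rightarrow> 'g set \<Rightarrow> bool" where
  "open_bisection G B \<longleftrightarrow> openin (gtop G) B \<and>
     (\<forall>p \<in> {grange G, gsource G}.
        openin (subtopology (gtop G) (unit_space G)) (p ` B) \<and>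
        homeomorphic_map (subtopology (gtop G) B) (subtopology (gtop G) (p ` B)) p)"

definition ample_groupoid :: "'g groupoid_data \<Rightarrow> bool" where
  "ample_groupoid G \<longleftrightarrow> topological_groupoid G \<and>
     (\<forall>U a. openin (gtop G) U \<and> a \<in> U \<longrightarrow>
        (\<exists>B. open_bisection G B \<and> compactin (gtop G) B \<and> a \<in> B \<and> B \<subseteq> U))"


section \<open>Ideals and the socle of a possibly non-unital algebra\<close>

text \<open>Addition and zero are those of the ambient type. Ideals of an algebra are
  linear subspaces, and homomorphisms of modules over an algebra are linear over the
  scalars; for algebras with local units, such as Steinberg algebras, this is automatic.\<close>

record ('k, 'v) algebra_data =
  acarrier :: "'v set"
  amult :: "'v \<Rightarrow> 'v \<Rightarrow> 'v"
  ascale :: "'k \<Rightarrow> 'v \<Rightarrow> 'v"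

definition left_ideal :: "('k, 'v::ab_group_add) algebra_data \<Rightarrow> 'v set \<Rightarrow> bool" where
  "left_ideal A I \<longleftrightarrow> I \<subseteq> acarrier A \<and> 0 \<in> I \<and>
     (\<forall>u \<in> I. \<forall>v \<in> I. u + v \<in> I) \<and>
     (\<forall>c. \<forall>u \<in> I. ascale A c u \<in> I) \<and>
     (\<forall>a \<in> acarrier A. \<forall>u \<in> I. amult A a u \<in> I)"

definition two_sided_ideal :: "('k, 'v::ab_group_add) algebra_data \<Rightarrow> 'v set \<Rightarrow> bool" where
  "two_sided_ideal A I \<longleftrightarrow> left_ideal A I \<and>
     (\<forall>a \<in> acarrier A. \<forall>u \<in> I. amult A u a \<in> I)"

definition ideal_generated :: "('k, 'v::ab_group_add) algebra_data \<Rightarrow> 'v set \<Rightarrow> 'v set" where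
  "ideal_generated A S = two_sided_ideal A hull S"

definition minimal_left_ideal :: "('k, 'v::ab_group_add) algebra_data \<Rightarrow> 'v set \<Rightarrow> bool" where
  "minimal_left_ideal A I \<longleftrightarrow> left_ideal A I \<and> I \<noteq> {0} \<and>
     (\<forall>J. left_ideal A J \<and> J \<subseteq> I \<longrightarrow> J = {0} \<or> J = I)"

definition subspace_sum :: "'v::ab_group_add set set \<Rightarrow> 'v set" where
  "subspace_sum \<I> = {\<Sum>I\<in>F. h I | F h. finite F \<and> F \<subseteq> \<I> \<and> (\<forall>I\<in>F. h I \<in> I)}"

definition socle :: "('k, 'v::ab_group_add) algebra_data \<Rightarrow> 'v set" where
  "socle A = subspace_sum {I. minimal_left_ideal A I}"

definition left_ideal_iso ::
  "('k, 'v::ab_group_add) algebra_data \<Rightarrow> 'v set \<Rightarrow> 'v set \<Rightarrow> bool" where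
  "left_ideal_iso A I J \<longleftrightarrow> (\<exists>\<phi>. bij_betw \<phi> I J \<and>
     (\<forall>u \<in> I. \<forall>v \<in> I. \<phi> (u + v) = \<phi> u + \<phi> v) \<and>
     (\<forall>c. \<forall>u \<in> I. \<phi> (ascale A c u) = ascale A c (\<phi> u)) \<and>
     (\<forall>a \<in> acarrier A. \<forall>u \<in> I. \<phi> (amult A a u) = amult A a (\<phi> u)))"

definition homogeneous_component ::
  "('k, 'v::ab_group_add) algebra_data \<Rightarrow> 'v set \<Rightarrow> 'v set" where
  "homogeneous_component A I = subspace_sum {J. left_ideal A J \<and> left_ideal_iso A J I}"

definition principal_left :: "('k, 'v) algebra_data \<Rightarrow> 'v \<Rightarrow> 'v set" where
  "principal_left A e = (\<lambda>a. amult A a e) ` acarrier A"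


section \<open>Steinberg algebras\<close>

definition locally_constant :: "'a topology \<Rightarrow> ('a \<Rightarrow> 'b) \<Rightarrow> bool" where
  "locally_constant T f \<longleftrightarrow>
     (\<forall>a \<in> topspace T. \<exists>U. openin T U \<and> a \<in> U \<and> (\<forall>b \<in> U. f b = f a))"

text \<open>The index set is restricted to nonzero factors, which makes it finite for \<open>f\<close> and \<open>g\<close>
  in the Steinberg algebra of an ample Hausdorff groupoid.\<close>

definition convolution ::
  "'g groupoid_data \<Rightarrow> ('g \<Rightarrow> 'k::field) \<Rightarrow> ('g \<Rightarrow> 'k) \<Rightarrow> 'g \<Rightarrow> 'k" where
  "convolution G f g c =
     (\<Sum>(a, b) \<in> {(a, b) \<in> comp_pairs G. gmult G a b = c \<and> f a \<noteq> 0 \<and> g b \<noteq> 0}. f a * g b)"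

text \<open>Functions on the groupoid are represented by functions on the whole type that vanish
  outside its underlying set. Addition is the pointwise one of \<open>Function_Algebras\<close>, whose
  pointwise product plays no role.\<close>

definition steinberg_algebra ::
  "'g groupoid_data \<Rightarrow> ('k::field, 'g \<Rightarrow> 'k) algebra_data" where
  "steinberg_algebra G =
     \<lparr> acarrier = {f. (\<forall>a. a \<notin> gcarrier G \<longrightarrow> f a = 0) \<and>
                      locally_constant (gtop G) f \<and>
                      compactin (gtop G) {a \<in> gcarrier G. f a \<noteq> 0}},
       amult = convolution G,
       ascale = (\<lambda>k f a. k * f a) \<rparr>"

end

theory Submission
  imports Defs
begin

text \<open>
  Write \<open>A\<close> for the Steinberg algebra, \<open>r\<close> and \<open>s\<close> for range and source. The core is that a
  minimal left ideal \<open>I\<close> sees only isolated points of the groupoid. For \<open>a\<close> in \<open>A\<close> the kernel of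
  right multiplication by \<open>a\<close> on \<open>I\<close> is a left ideal, hence is \<open>0\<close> or \<open>I\<close>
  (\<open>right_mult_zero_or_injective\<close>). Take a nonzero \<open>f\<close> in \<open>I\<close>, a source \<open>y\<close> of its support, and a
  compact open set \<open>W\<close> of units around \<open>y\<close>. Right multiplication by \<open>1\<^sub>W\<close> does not kill \<open>f\<close>, so it is
  injective on \<open>I\<close>, and \<open>1\<^sub>V f 1\<^sub>W = 0\<close> forces \<open>1\<^sub>V f = 0\<close>: the supports of \<open>f\<close> and \<open>f 1\<^sub>W\<close> have the same
  ranges. Shrinking \<open>W\<close> to \<open>y\<close> leaves only the ranges of the finitely many support points
  with source \<open>y\<close>. So the support of \<open>f\<close> lies over finitely many units, is finite, and, being open
  in a Hausdorff space, consists of isolated points (\<open>minimal_left_ideal_isolated\<close>).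

  Let \<open>y\<close> be the source of a point of the support of \<open>f\<close> and \<open>e = 1\<^sub>y\<close>, now an element of \<open>A\<close>. Then
  \<open>e A e\<close> is the group algebra of the isotropy group at \<open>y\<close>, and \<open>e I e\<close> is a minimal left ideal of it
  (\<open>corner_minimal\<close>), nonzero after translating \<open>f\<close>. The group algebra therefore has a nonzero
  socle, and by hypothesis the isotropy at \<open>y\<close> is trivial. As \<open>f\<close> is the finite sum of the
  \<open>f 1\<^sub>y\<close>, it lies in the ideal generated by these \<open>1\<^sub>y\<close>.

  Conversely, if \<open>x\<close> is isolated with trivial isotropy, every nonzero element of \<open>A 1\<^sub>x\<close> can be
  translated back to a nonzero multiple of \<open>1\<^sub>x\<close>, so \<open>A 1\<^sub>x\<close> is minimal
  (\<open>principal_left_unit_minimal\<close>). For minimal \<open>I\<close>, a right translate \<open>I a\<close> is \<open>0\<close> or isomorphic to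
  \<open>I\<close>, so the sum of any class of minimal left ideals closed under isomorphism is a two-sided ideal
  (\<open>subspace_sum_two_sided\<close>). This applies to the socle and to each homogeneous component, which
  gives the inclusions from right to left. Finally, an isomorphism \<open>\<phi>\<close> from \<open>A 1\<^sub>x\<close> onto \<open>J\<close>
  satisfies \<open>\<phi> 1\<^sub>x = 1\<^sub>x (\<phi> 1\<^sub>x)\<close>, so \<open>J = A (\<phi> 1\<^sub>x)\<close> lies in the two-sided ideal generated by \<open>1\<^sub>x\<close>.
\<close>

section \<open>Groupoids\<close>

locale groupoid_structure =
  fixes G :: "'g groupoid_data"
  assumes groupoid: "groupoid G"
begin

abbreviation mult_in (infixl "\<cdot>" 75) where "a \<cdot> b \<equiv> gmult G a b"

lemma comp_pairs_carrier: "(a, b) \<in> comp_pairs G \<Longrightarrow> a \<in> gcarrier G \<and> b \<in> gcarrier G"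
  using groupoid unfolding groupoid_def by blast

lemma comp_pairs_closed: "(a, b) \<in> comp_pairs G \<Longrightarrow> a \<cdot> b \<in> gcarrier G"
  using groupoid unfolding groupoid_def by blast

lemma inv_closed [simp]: "a \<in> gcarrier G \<Longrightarrow> ginv G a \<in> gcarrier G"
  using groupoid unfolding groupoid_def by blast

lemma inv_inv [simp]: "a \<in> gcarrier G \<Longrightarrow> ginv G (ginv G a) = a"
  using groupoid unfolding groupoid_def by blast

lemma inv_comp: "a \<in> gcarrier G \<Longrightarrow> (ginv G a, a) \<in> comp_pairs G"
  using groupoid unfolding groupoid_def by blast

lemma comp_inv: "a \<in> gcarrier G \<Longrightarrow> (a, ginv G a) \<in> comp_pairs G"
  using inv_comp[of "ginv G a"] by simp

lemma comp_pairs_assoc: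
  "(a, b) \<in> comp_pairs G \<Longrightarrow> (b, c) \<in> comp_pairs G \<Longrightarrow>
     (a \<cdot> b, c) \<in> comp_pairs G \<and> (a, b \<cdot> c) \<in> comp_pairs G \<and> (a \<cdot> b) \<cdot> c = a \<cdot> (b \<cdot> c)"
  using groupoid unfolding groupoid_def by blast

lemma comp_pairs_cancel:
  "(a, b) \<in> comp_pairs G \<Longrightarrow> ginv G a \<cdot> (a \<cdot> b) = b \<and> (a \<cdot> b) \<cdot> ginv G b = a"
  using groupoid unfolding groupoid_def by blast

lemma range_mult_self [simp]: "a \<in> gcarrier G \<Longrightarrow> grange G a \<cdot> a = a"
  using comp_pairs_cancel[OF comp_inv, of a] by (simp add: grange_def)

lemma mult_source_self [simp]: "a \<in> gcarrier G \<Longrightarrow> a \<cdot> gsource G a = a"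
  using range_mult_self[of a] comp_pairs_assoc[OF comp_inv inv_comp, of a]
  by (simp add: grange_def gsource_def)

text \<open>Both sides of \<open>s a = r b\<close> arise by bracketing \<open>a\<^sup>-\<^sup>1 a b b\<^sup>-\<^sup>1\<close> in two ways. Conversely, \<open>a\<close> is
  composable with \<open>s a\<close>, and \<open>r b\<close> with \<open>b\<close>; when these units agree, associativity composes the two.\<close>
lemma comp_pairs_iff:
  "(a, b) \<in> comp_pairs G \<longleftrightarrow> a \<in> gcarrier G \<and> b \<in> gcarrier G \<and> gsource G a = grange G b"
proof
  assume ab: "(a, b) \<in> comp_pairs G"
  then have "a \<in> gcarrier G" "b \<in> gcarrier G"
    using comp_pairs_carrier by auto
  moreover have "ginv G a \<cdot> ((a \<cdot> b) \<cdot> ginv G b) = (ginv G a \<cdot> (a \<cdot> b)) \<cdot> ginv G b"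
    using comp_pairs_assoc ab inv_comp comp_inv calculation by metis
  ultimately show "a \<in> gcarrier G \<and> b \<in> gcarrier G \<and> gsource G a = grange G b"
    using comp_pairs_cancel[OF ab] by (simp add: grange_def gsource_def)
next
  assume *: "a \<in> gcarrier G \<and> b \<in> gcarrier G \<and> gsource G a = grange G b"
  have "(a, gsource G a) \<in> comp_pairs G"
    using comp_pairs_assoc[OF comp_inv inv_comp, of a] * by (simp add: gsource_def)
  moreover have "(gsource G a, b) \<in> comp_pairs G"
    using comp_pairs_assoc[OF comp_inv inv_comp, of b] * by (simp add: grange_def)
  ultimately show "(a, b) \<in> comp_pairs G"
    using comp_pairs_assoc[of a "gsource G a" b] * by simp
qed

lemma mult_closed [simp]:
  "a \<in> gcarrier G \<Longrightarrow> b \<in> gcarrier G \<Longrightarrow> gsource G a = grange G b \<Longrightarrow> a \<cdot> b \<in> gcarrier G"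
  using comp_pairs_closed comp_pairs_iff by blast

lemma range_inv [simp]: "a \<in> gcarrier G \<Longrightarrow> grange G (ginv G a) = gsource G a"
  and source_inv [simp]: "a \<in> gcarrier G \<Longrightarrow> gsource G (ginv G a) = grange G a"
  by (simp_all add: grange_def gsource_def)

lemma range_closed [simp]: "a \<in> gcarrier G \<Longrightarrow> grange G a \<in> gcarrier G"
  and source_closed [simp]: "a \<in> gcarrier G \<Longrightarrow> gsource G a \<in> gcarrier G"
  using comp_pairs_closed[OF comp_inv] comp_pairs_closed[OF inv_comp]
  by (simp_all add: grange_def gsource_def)

lemma range_mult [simp]:
  assumes "a \<in> gcarrier G" "b \<in> gcarrier G" "gsource G a = grange G b"
  shows "grange G (a \<cdot> b) = grange G a"
  using comp_pairs_assoc[OF inv_comp, of a b] comp_pairs_iff[of "ginv G a" "a \<cdot> b"] assms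
  by (simp add: comp_pairs_iff)

lemma source_mult [simp]:
  assumes "a \<in> gcarrier G" "b \<in> gcarrier G" "gsource G a = grange G b"
  shows "gsource G (a \<cdot> b) = gsource G b"
  using comp_pairs_assoc[OF _ comp_inv, of a b] comp_pairs_iff[of "a \<cdot> b" "ginv G b"] assms
  by (simp add: comp_pairs_iff)

lemma mult_assoc:
  "a \<in> gcarrier G \<Longrightarrow> b \<in> gcarrier G \<Longrightarrow> c \<in> gcarrier G \<Longrightarrow> gsource G a = grange G b \<Longrightarrow>
     gsource G b = grange G c \<Longrightarrow> (a \<cdot> b) \<cdot> c = a \<cdot> (b \<cdot> c)"
  using comp_pairs_assoc comp_pairs_iff by blast

lemma inv_mult_cancel [simp]:
  "a \<in> gcarrier G \<Longrightarrow> b \<in> gcarrier G \<Longrightarrow> gsource G a = grange G b \<Longrightarrow> ginv G a \<cdot> (a \<cdot> b) = b"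
  and mult_inv_cancel [simp]:
  "a \<in> gcarrier G \<Longrightarrow> b \<in> gcarrier G \<Longrightarrow> gsource G a = grange G b \<Longrightarrow> (a \<cdot> b) \<cdot> ginv G b = a"
  using comp_pairs_cancel comp_pairs_iff by blast+

lemma mult_inv_mult [simp]:
  "a \<in> gcarrier G \<Longrightarrow> c \<in> gcarrier G \<Longrightarrow> grange G a = grange G c \<Longrightarrow> a \<cdot> (ginv G a \<cdot> c) = c"
  using inv_mult_cancel[of "ginv G a" c] by simp

lemma mult_mult_inv [simp]:
  "b \<in> gcarrier G \<Longrightarrow> c \<in> gcarrier G \<Longrightarrow> gsource G b = gsource G c \<Longrightarrow> (c \<cdot> ginv G b) \<cdot> b = c"
  using mult_inv_cancel[of c "ginv G b"] by simp

lemma range_range [simp]: "a \<in> gcarrier G \<Longrightarrow> grange G (grange G a) = grange G a"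
  and source_range [simp]: "a \<in> gcarrier G \<Longrightarrow> gsource G (grange G a) = grange G a"
  using range_mult[of a "ginv G a"] source_mult[of a "ginv G a"]
  by (simp_all add: grange_def[symmetric])

lemma range_in_unit_space [simp]: "a \<in> gcarrier G \<Longrightarrow> grange G a \<in> unit_space G"
  by (simp add: unit_space_def)

lemma source_in_unit_space [simp]: "a \<in> gcarrier G \<Longrightarrow> gsource G a \<in> unit_space G"
  using range_in_unit_space[of "ginv G a"] by simp

lemma unit_closed [simp]: "x \<in> unit_space G \<Longrightarrow> x \<in> gcarrier G"
  and range_unit [simp]: "x \<in> unit_space G \<Longrightarrow> grange G x = x"
  and source_unit [simp]: "x \<in> unit_space G \<Longrightarrow> gsource G x = x"
  by (auto simp: unit_space_def)

lemma inv_unit [simp]: "x \<in> unit_space G \<Longrightarrow> ginv G x = x"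
  using mult_source_self[of "ginv G x"] by (metis gsource_def inv_closed range_unit
      source_inv source_unit unit_closed)

lemma unit_in_isotropy [simp]: "x \<in> unit_space G \<Longrightarrow> x \<in> isotropy G x"
  by (simp add: isotropy_def)

section \<open>Convolution\<close>

abbreviation conv_in (infixl "\<star>" 70) where "f \<star> g \<equiv> convolution G f g"

lemma convolution_outside: "c \<notin> gcarrier G \<Longrightarrow> (f \<star> g) c = 0"
proof -
  assume "c \<notin> gcarrier G"
  then have *: "{(a, b) \<in> comp_pairs G. a \<cdot> b = c \<and> f a \<noteq> 0 \<and> g b \<noteq> 0} = {}"
    using comp_pairs_closed by blast
  show ?thesis unfolding convolution_def * by simp
qed

text \<open>A factorisation \<open>c = d b\<close> is determined by \<open>d\<close>, which is an arbitrary element with the range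
  of \<open>c\<close>. The finite set \<open>F\<close> is a parameter, so that one \<open>F\<close>, chosen from \<open>f\<close> alone, serves all \<open>g\<close>
  and linearity in \<open>g\<close> can be read off.\<close>
lemma convolution_range_sum:
  assumes "c \<in> gcarrier G" "finite F"
    and F: "\<And>d. d \<in> F \<Longrightarrow> d \<in> gcarrier G \<and> grange G d = grange G c"
    and supp: "\<And>d. d \<in> gcarrier G \<Longrightarrow> grange G d = grange G c \<Longrightarrow> f d \<noteq> 0 \<Longrightarrow> d \<in> F"
  shows "(f \<star> g) c = (\<Sum>d\<in>F. f d * g (ginv G d \<cdot> c))"
proof -
  let ?F = "{d \<in> F. f d \<noteq> 0 \<and> g (ginv G d \<cdot> c) \<noteq> 0}"
  have "{(a, b) \<in> comp_pairs G. a \<cdot> b = c \<and> f a \<noteq> 0 \<and> g b \<noteq> 0}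
          = (\<lambda>d. (d, ginv G d \<cdot> c)) ` ?F"
  proof (intro equalityI subsetI)
    fix p assume "p \<in> {(a, b) \<in> comp_pairs G. a \<cdot> b = c \<and> f a \<noteq> 0 \<and> g b \<noteq> 0}"
    then obtain a b where p: "p = (a, b)" "a \<in> gcarrier G" "b \<in> gcarrier G"
      "gsource G a = grange G b" "c = a \<cdot> b" "f a \<noteq> 0" "g b \<noteq> 0"
      by (auto simp: comp_pairs_iff)
    then show "p \<in> (\<lambda>d. (d, ginv G d \<cdot> c)) ` ?F"
      using supp[of a] by (intro image_eqI[of _ _ a]) simp_all
  next
    fix p assume "p \<in> (\<lambda>d. (d, ginv G d \<cdot> c)) ` ?F"
    then show "p \<in> {(a, b) \<in> comp_pairs G. a \<cdot> b = c \<and> f a \<noteq> 0 \<and> g b \<noteq> 0}"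
      using F assms(1) by (auto simp: comp_pairs_iff)
  qed
  then have "(f \<star> g) c = (\<Sum>d\<in>?F. f d * g (ginv G d \<cdot> c))"
    by (simp add: convolution_def sum.reindex inj_on_def)
  also have "\<dots> = (\<Sum>d\<in>F. f d * g (ginv G d \<cdot> c))"
    using assms(2) by (intro sum.mono_neutral_left) auto
  finally show ?thesis .
qed

lemma convolution_source_sum:
  assumes "c \<in> gcarrier G" "finite F"
    and F: "\<And>d. d \<in> F \<Longrightarrow> d \<in> gcarrier G \<and> gsource G d = gsource G c"
    and supp: "\<And>d. d \<in> gcarrier G \<Longrightarrow> gsource G d = gsource G c \<Longrightarrow> g d \<noteq> 0 \<Longrightarrow> d \<in> F"
  shows "(f \<star> g) c = (\<Sum>d\<in>F. f (c \<cdot> ginv G d) * g d)"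
proof -
  let ?F = "{d \<in> F. f (c \<cdot> ginv G d) \<noteq> 0 \<and> g d \<noteq> 0}"
  have "{(a, b) \<in> comp_pairs G. a \<cdot> b = c \<and> f a \<noteq> 0 \<and> g b \<noteq> 0}
          = (\<lambda>d. (c \<cdot> ginv G d, d)) ` ?F"
  proof (intro equalityI subsetI)
    fix p assume "p \<in> {(a, b) \<in> comp_pairs G. a \<cdot> b = c \<and> f a \<noteq> 0 \<and> g b \<noteq> 0}"
    then obtain a b where p: "p = (a, b)" "a \<in> gcarrier G" "b \<in> gcarrier G"
      "gsource G a = grange G b" "c = a \<cdot> b" "f a \<noteq> 0" "g b \<noteq> 0"
      by (auto simp: comp_pairs_iff)
    then show "p \<in> (\<lambda>d. (c \<cdot> ginv G d, d)) ` ?F"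
      using supp[of b] by (intro image_eqI[of _ _ b]) simp_all
  next
    fix p assume "p \<in> (\<lambda>d. (c \<cdot> ginv G d, d)) ` ?F"
    then show "p \<in> {(a, b) \<in> comp_pairs G. a \<cdot> b = c \<and> f a \<noteq> 0 \<and> g b \<noteq> 0}"
      using F assms(1) by (auto simp: comp_pairs_iff)
  qed
  then have "(f \<star> g) c = (\<Sum>d\<in>?F. f (c \<cdot> ginv G d) * g d)"
    by (simp add: convolution_def sum.reindex inj_on_def)
  also have "\<dots> = (\<Sum>d\<in>F. f (c \<cdot> ginv G d) * g d)"
    using assms(2) by (intro sum.mono_neutral_left) auto
  finally show ?thesis .
qed

text \<open>The only factorisation of \<open>c\<close> with a unit on the left is \<open>c = (r c) c\<close>. Characteristic functions of
  sets of units thus serve to localise a function at given ranges or sources.\<close>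
lemma convolution_units_left:
  assumes "V \<subseteq> unit_space G" "c \<in> gcarrier G"
  shows "(indicator V \<star> f) c = (if grange G c \<in> V then f c else 0)"
proof -
  have "(indicator V \<star> f) c
      = (\<Sum>d\<in>{grange G c}. indicator V d * f (ginv G d \<cdot> c))"
    using assms by (intro convolution_range_sum) (auto simp: indicator_def split: if_splits)
  then show ?thesis using assms by simp
qed

lemma convolution_units_right:
  assumes "V \<subseteq> unit_space G" "c \<in> gcarrier G"
  shows "(f \<star> indicator V) c = (if gsource G c \<in> V then f c else 0)"
proof -
  have "(f \<star> indicator V) c
      = (\<Sum>d\<in>{gsource G c}. f (c \<cdot> ginv G d) * indicator V d)"
    using assms by (intro convolution_source_sum) (auto simp: indicator_def split: if_splits)
  then show ?thesis using assms by simp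
qed

lemma convolution_point_mass_left:
  assumes "a \<in> gcarrier G" "c \<in> gcarrier G"
  shows "(indicator {a} \<star> f) c = (if grange G c = grange G a then f (ginv G a \<cdot> c) else 0)"
proof -
  have "(indicator {a} \<star> f) c = (\<Sum>d\<in>(if grange G c = grange G a then {a} else {}).
      indicator {a} d * f (ginv G d \<cdot> c))"
    using assms by (intro convolution_range_sum) (auto simp: indicator_def split: if_splits)
  then show ?thesis by simp
qed

lemma convolution_supportE:
  assumes "(f \<star> g) c \<noteq> 0"
  obtains a b where "a \<in> gcarrier G" "b \<in> gcarrier G" "gsource G a = grange G b"
    "c = a \<cdot> b" "f a \<noteq> 0" "g b \<noteq> 0"
proof -
  have "{(a, b) \<in> comp_pairs G. a \<cdot> b = c \<and> f a \<noteq> 0 \<and> g b \<noteq> 0} \<noteq> {}"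
    using assms unfolding convolution_def by (metis (no_types, lifting) sum.empty)
  then show ?thesis using that by (auto simp: comp_pairs_iff)
qed

text \<open>Expanding \<open>f\<close> along range fibres and \<open>h\<close> along source fibres turns both sides into the same
  finite double sum, in either order of summation.\<close>
lemma convolution_assoc:
  assumes f: "\<And>x. finite {d \<in> gcarrier G. grange G d = x \<and> f d \<noteq> 0}"
    and h: "\<And>x. finite {d \<in> gcarrier G. gsource G d = x \<and> h d \<noteq> 0}"
  shows "(f \<star> g) \<star> h = f \<star> (g \<star> h)"
proof
  fix c
  show "((f \<star> g) \<star> h) c = (f \<star> (g \<star> h)) c"
  proof (cases "c \<in> gcarrier G")
    case c: True
    let ?F = "{d \<in> gcarrier G. grange G d = grange G c \<and> f d \<noteq> 0}"
    let ?H = "{d \<in> gcarrier G. gsource G d = gsource G c \<and> h d \<noteq> 0}"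
    have fg: "(f \<star> g) (c \<cdot> ginv G b) = (\<Sum>a\<in>?F. f a * g (ginv G a \<cdot> (c \<cdot> ginv G b)))"
      if "b \<in> ?H" for b
      using that c f by (intro convolution_range_sum) auto
    have gh: "(g \<star> h) (ginv G a \<cdot> c) = (\<Sum>b\<in>?H. g ((ginv G a \<cdot> c) \<cdot> ginv G b) * h b)"
      if "a \<in> ?F" for a
      using that c h by (intro convolution_source_sum) auto
    have "((f \<star> g) \<star> h) c = (\<Sum>b\<in>?H. (f \<star> g) (c \<cdot> ginv G b) * h b)"
      using c h by (intro convolution_source_sum) auto
    also have "\<dots> = (\<Sum>b\<in>?H. \<Sum>a\<in>?F. f a * g (ginv G a \<cdot> (c \<cdot> ginv G b)) * h b)"
      by (intro sum.cong refl) (simp only: fg sum_distrib_right)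
    also have "\<dots> = (\<Sum>a\<in>?F. \<Sum>b\<in>?H. f a * g (ginv G a \<cdot> (c \<cdot> ginv G b)) * h b)"
      by (rule sum.swap)
    also have "\<dots> = (\<Sum>a\<in>?F. \<Sum>b\<in>?H. f a * (g ((ginv G a \<cdot> c) \<cdot> ginv G b) * h b))"
      using c by (intro sum.cong refl) (auto simp: mult_assoc mult.assoc)
    also have "\<dots> = (\<Sum>a\<in>?F. f a * (g \<star> h) (ginv G a \<cdot> c))"
      by (intro sum.cong refl) (simp only: gh sum_distrib_left)
    also have "\<dots> = (f \<star> (g \<star> h)) c"
      using c f by (intro convolution_range_sum[symmetric]) auto
    finally show ?thesis .
  qed (simp add: convolution_outside)
qed

end

section \<open>Topology of ample Hausdorff groupoids\<close>

locale ample_hausdorff_groupoid =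
  fixes G :: "'g groupoid_data"
  assumes ample: "ample_groupoid G"
    and hausdorff: "Hausdorff_space (gtop G)"

sublocale ample_hausdorff_groupoid \<subseteq> groupoid_structure
  using ample by unfold_locales (simp add: ample_groupoid_def topological_groupoid_def)

context ample_hausdorff_groupoid
begin

lemma bisection_neighbourhood:
  assumes "openin (gtop G) U" "a \<in> U"
  obtains B where "open_bisection G B" "compactin (gtop G) B" "a \<in> B" "B \<subseteq> U"
  using ample assms unfolding ample_groupoid_def by blast

lemma bisection_open: "open_bisection G B \<Longrightarrow> openin (gtop G) B"
  by (simp add: open_bisection_def)

lemma bisection_inj:
  assumes "open_bisection G B"
  shows "inj_on (grange G) B" "inj_on (gsource G) B"
proof -
  have "topspace (subtopology (gtop G) B) = B"
    using bisection_open[OF assms] openin_subset by fastforce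
  then show "inj_on (grange G) B" "inj_on (gsource G) B"
    using assms unfolding open_bisection_def homeomorphic_eq_injective_perfect_map
      homeomorphic_map_def by auto
qed

lemma continuous_inv: "continuous_map (gtop G) (gtop G) (ginv G)"
  using ample by (simp add: ample_groupoid_def topological_groupoid_def)

lemma continuous_mult:
  "continuous_map (subtopology (prod_topology (gtop G) (gtop G)) (comp_pairs G)) (gtop G)
     (\<lambda>(a, b). a \<cdot> b)"
  using ample by (simp add: ample_groupoid_def topological_groupoid_def)

lemma continuous_range: "continuous_map (gtop G) (gtop G) (grange G)"
proof -
  have "continuous_map (gtop G) (subtopology (prod_topology (gtop G) (gtop G)) (comp_pairs G))
      (\<lambda>a. (a, ginv G a))"
    using continuous_inv comp_inv
    by (auto simp: continuous_map_in_subtopology intro!: continuous_map_pairedI)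
  from continuous_map_compose[OF this continuous_mult] show ?thesis
    by (simp add: o_def grange_def[abs_def])
qed

lemma continuous_source: "continuous_map (gtop G) (gtop G) (gsource G)"
proof (rule continuous_map_eq)
  show "continuous_map (gtop G) (gtop G) (grange G \<circ> ginv G)"
    by (rule continuous_map_compose[OF continuous_inv continuous_range])
qed auto

text \<open>Let \<open>B\<close> be an open bisection around a unit. If both \<open>a\<close> and \<open>r a\<close> lie in \<open>B\<close>, then injectivity of
  \<open>r\<close> on \<open>B\<close> gives \<open>a = r a\<close>; such \<open>a\<close> fill a neighbourhood of the unit.\<close>
lemma unit_space_open: "openin (gtop G) (unit_space G)"
proof (subst openin_subopen, intro ballI)
  fix x assume x: "x \<in> unit_space G"
  obtain B where B: "open_bisection G B" "x \<in> B"
    using bisection_neighbourhood[of "gcarrier G" x] x by auto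
  let ?V = "{a \<in> gcarrier G. grange G a \<in> B} \<inter> B"
  have "openin (gtop G) ?V"
    using openin_continuous_map_preimage[OF continuous_range bisection_open[OF B(1)]]
      bisection_open[OF B(1)] by blast
  moreover have "x \<in> ?V" using x B by simp
  moreover have "?V \<subseteq> unit_space G"
  proof
    fix a assume a: "a \<in> ?V"
    then have "grange G a = a"
      using bisection_inj(1)[OF B(1)] by (auto elim!: inj_onD)
    then show "a \<in> unit_space G" using a range_in_unit_space[of a] by simp
  qed
  ultimately show "\<exists>T. openin (gtop G) T \<and> x \<in> T \<and> T \<subseteq> unit_space G" by blast
qed

lemma bisection_image_open:
  assumes "open_bisection G B"
  shows "openin (gtop G) (grange G ` B)" "openin (gtop G) (gsource G ` B)"
  using assms unit_space_open openin_trans_full unfolding open_bisection_def by blast+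

lemma unit_neighbourhood:
  assumes "x \<in> unit_space G" "openin (gtop G) U" "x \<in> U"
  obtains W where "openin (gtop G) W" "compactin (gtop G) W" "W \<subseteq> unit_space G" "x \<in> W" "W \<subseteq> U"
  using bisection_neighbourhood[of "unit_space G \<inter> U" x] assms unit_space_open bisection_open
  by (metis IntI le_inf_iff openin_Int)

text \<open>Range and source are local homeomorphisms, so isolated points are exactly those over isolated
  units.\<close>
lemma isolated_range_iff:
  assumes a: "a \<in> gcarrier G"
  shows "openin (gtop G) {grange G a} \<longleftrightarrow> openin (gtop G) {a}"
proof
  assume "openin (gtop G) {a}"
  then obtain B where "open_bisection G B" "a \<in> B" "B \<subseteq> {a}"
    using bisection_neighbourhood[of "{a}" a] by blast
  moreover then have "B = {a}" by blast
  ultimately show "openin (gtop G) {grange G a}" using bisection_image_open(1) by fastforce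
next
  assume x: "openin (gtop G) {grange G a}"
  obtain B where B: "open_bisection G B" "a \<in> B"
    using bisection_neighbourhood[of "gcarrier G" a] a by auto
  have "openin (gtop G) ({c \<in> gcarrier G. grange G c \<in> {grange G a}} \<inter> B)"
    using openin_continuous_map_preimage[OF continuous_range x] bisection_open[OF B(1)] by blast
  moreover have "{c \<in> gcarrier G. grange G c \<in> {grange G a}} \<inter> B = {a}"
    using a B bisection_inj(1)[OF B(1)] by (auto dest: inj_onD)
  ultimately show "openin (gtop G) {a}" by simp
qed

lemma isolated_source_iff:
  assumes a: "a \<in> gcarrier G"
  shows "openin (gtop G) {gsource G a} \<longleftrightarrow> openin (gtop G) {a}"
proof
  assume "openin (gtop G) {a}"
  then obtain B where "open_bisection G B" "a \<in> B" "B \<subseteq> {a}"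
    using bisection_neighbourhood[of "{a}" a] by blast
  moreover then have "B = {a}" by blast
  ultimately show "openin (gtop G) {gsource G a}" using bisection_image_open(2) by fastforce
next
  assume x: "openin (gtop G) {gsource G a}"
  obtain B where B: "open_bisection G B" "a \<in> B"
    using bisection_neighbourhood[of "gcarrier G" a] a by auto
  have "openin (gtop G) ({c \<in> gcarrier G. gsource G c \<in> {gsource G a}} \<inter> B)"
    using openin_continuous_map_preimage[OF continuous_source x] bisection_open[OF B(1)] by blast
  moreover have "{c \<in> gcarrier G. gsource G c \<in> {gsource G a}} \<inter> B = {a}"
    using a B bisection_inj(2)[OF B(1)] by (auto dest: inj_onD)
  ultimately show "openin (gtop G) {a}" by simp
qed

text \<open>Finitely many open bisections cover the compact set, and each meets a fibre at most once.\<close>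
lemma compact_fibre_finite:
  assumes "compactin (gtop G) C"
  shows "finite {a \<in> C. grange G a = x}" "finite {a \<in> C. gsource G a = x}"
proof -
  have "\<forall>U\<in>{B. open_bisection G B}. openin (gtop G) U" using bisection_open by blast
  moreover have "C \<subseteq> \<Union>{B. open_bisection G B}"
  proof
    fix a assume "a \<in> C"
    then show "a \<in> \<Union>{B. open_bisection G B}"
      using bisection_neighbourhood[OF openin_topspace, of a] compactin_subset_topspace[OF assms]
      by blast
  qed
  ultimately obtain \<F> where \<F>: "finite \<F>" "\<F> \<subseteq> {B. open_bisection G B}" "C \<subseteq> \<Union>\<F>"
    using assms unfolding compactin_def by meson
  have fin: "finite {a \<in> B. p a = x}" if "inj_on p B" for B and p :: "'g \<Rightarrow> 'g"
  proof -
    have "inj_on p {a \<in> B. p a = x}" "p ` {a \<in> B. p a = x} \<subseteq> {x}"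
      using that by (auto simp: inj_on_def)
    then show ?thesis by (meson finite.simps finite_imageD finite_subset)
  qed
  have cover: "finite {a \<in> C. p a = x}" if "\<And>B. B \<in> \<F> \<Longrightarrow> inj_on p B" for p
  proof (rule finite_subset)
    show "{a \<in> C. p a = x} \<subseteq> (\<Union>B\<in>\<F>. {a \<in> B. p a = x})"
      using \<F>(3) by auto
    show "finite (\<Union>B\<in>\<F>. {a \<in> B. p a = x})"
      using \<F>(1) that fin by (intro finite_UN_I) simp_all
  qed
  show "finite {a \<in> C. grange G a = x}" "finite {a \<in> C. gsource G a = x}"
    using \<F>(2) bisection_inj by (auto intro!: cover)
qed

end

section \<open>Sums of left ideals\<close>

lemma amult_steinberg [simp]: "amult (steinberg_algebra G) = convolution G"
  and ascale_steinberg [simp]: "ascale (steinberg_algebra G) k f = (\<lambda>a. k * f a)"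
  by (simp_all add: steinberg_algebra_def)

lemma left_idealD:
  assumes "left_ideal A I"
  shows "I \<subseteq> acarrier A" "0 \<in> I"
    "\<And>u v. u \<in> I \<Longrightarrow> v \<in> I \<Longrightarrow> u + v \<in> I"
    "\<And>c u. u \<in> I \<Longrightarrow> ascale A c u \<in> I"
    "\<And>a u. a \<in> acarrier A \<Longrightarrow> u \<in> I \<Longrightarrow> amult A a u \<in> I"
  using assms unfolding left_ideal_def by blast+

lemma left_ideal_sum: "left_ideal A I \<Longrightarrow> (\<And>i. i \<in> F \<Longrightarrow> g i \<in> I) \<Longrightarrow> (\<Sum>i\<in>F. g i) \<in> I"
  by (induction F rule: infinite_finite_induct) (auto simp: left_idealD)

lemma minimal_left_idealD:
  assumes "minimal_left_ideal A I"
  shows "left_ideal A I" "I \<noteq> {0}" "\<And>J. left_ideal A J \<Longrightarrow> J \<subseteq> I \<Longrightarrow> J = {0} \<or> J = I"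
  using assms unfolding minimal_left_ideal_def by blast+

lemma zero_in_subspace_sum: "0 \<in> subspace_sum \<I>"
  unfolding subspace_sum_def by (auto intro!: exI[of _ "{}"])

lemma subspace_sum_superset:
  assumes "I \<in> \<I>"
  shows "I \<subseteq> subspace_sum \<I>"
proof
  fix u assume "u \<in> I"
  then show "u \<in> subspace_sum \<I>"
    using assms unfolding subspace_sum_def
    by (auto intro!: exI[of _ "{I}"] exI[of _ "\<lambda>_. u"])
qed

lemma subspace_sum_induct [consumes 1, case_names zero add]:
  assumes "z \<in> subspace_sum \<I>" and "P 0"
    and "\<And>I u v. I \<in> \<I> \<Longrightarrow> u \<in> I \<Longrightarrow> P v \<Longrightarrow> P (u + v)"
  shows "P z"
proof -
  obtain F h where z: "z = (\<Sum>I\<in>F. h I)" and F: "finite F" "F \<subseteq> \<I>" "\<forall>I\<in>F. h I \<in> I"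
    using assms(1) unfolding subspace_sum_def by blast
  from F have "P (\<Sum>I\<in>F. h I)"
    by (induction F rule: finite_induct) (auto intro: assms(2,3))
  then show ?thesis by (simp add: z)
qed

text \<open>If \<open>I\<close> already occurs among the summands of \<open>w\<close>, then \<open>u\<close> has to be merged into its term, since
  a member of the sum has one summand for each ideal.\<close>
lemma subspace_sum_add_member:
  assumes \<I>: "\<And>I. I \<in> \<I> \<Longrightarrow> left_ideal A I"
    and "w \<in> subspace_sum \<I>" "I \<in> \<I>" "u \<in> I"
  shows "u + w \<in> subspace_sum \<I>"
proof -
  obtain F h where w: "w = (\<Sum>J\<in>F. h J)" and F: "finite F" "F \<subseteq> \<I>" "\<forall>J\<in>F. h J \<in> J"
    using assms(2) unfolding subspace_sum_def by blast
  define h' where "h' J = (if J = I then u else 0) + (if J \<in> F then h J else 0)" for J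
  have "(\<Sum>J\<in>insert I F. if J \<in> F then h J else 0) = w"
    unfolding w using F(1) by (intro sum.mono_neutral_cong_right) auto
  then have "u + w = (\<Sum>J\<in>insert I F. h' J)"
    using F(1) unfolding h'_def by (subst sum.distrib) (simp add: sum.delta')
  moreover have "h' J \<in> J" if "J \<in> insert I F" for J
    using that F(2,3) assms(3,4) left_idealD(2,3)[OF \<I>, of J] unfolding h'_def by auto
  ultimately show ?thesis
    using F(1,2) assms(3) unfolding subspace_sum_def by blast
qed

lemma subspace_sum_add:
  assumes \<I>: "\<And>I. I \<in> \<I> \<Longrightarrow> left_ideal A I"
    and "z \<in> subspace_sum \<I>" "w \<in> subspace_sum \<I>"
  shows "z + w \<in> subspace_sum \<I>"
  using assms(2)
  by (induction rule: subspace_sum_induct)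
    (auto simp: assms(3) add.assoc intro: subspace_sum_add_member[OF \<I>])

lemma subspace_sum_subset_left_ideal:
  assumes "left_ideal A T" "\<And>I. I \<in> \<I> \<Longrightarrow> I \<subseteq> T"
  shows "subspace_sum \<I> \<subseteq> T"
proof
  fix z assume "z \<in> subspace_sum \<I>"
  then show "z \<in> T"
    using assms(2) left_idealD(2,3)[OF assms(1)] by (induction rule: subspace_sum_induct) blast+
qed

lemma left_ideal_iso_sym:
  assumes I: "left_ideal A I" and "left_ideal_iso A I J"
  shows "left_ideal_iso A J I"
proof -
  obtain \<phi> where \<phi>: "bij_betw \<phi> I J" "\<And>u v. u \<in> I \<Longrightarrow> v \<in> I \<Longrightarrow> \<phi> (u + v) = \<phi> u + \<phi> v"
    "\<And>c u. u \<in> I \<Longrightarrow> \<phi> (ascale A c u) = ascale A c (\<phi> u)"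
    "\<And>a u. a \<in> acarrier A \<Longrightarrow> u \<in> I \<Longrightarrow> \<phi> (amult A a u) = amult A a (\<phi> u)"
    using assms(2) unfolding left_ideal_iso_def by blast
  let ?\<psi> = "inv_into I \<phi>"
  have \<psi>: "?\<psi> u \<in> I \<and> \<phi> (?\<psi> u) = u" if "u \<in> J" for u
    using that bij_betw_inv_into_right[OF \<phi>(1)] bij_betw_apply[OF bij_betw_inv_into[OF \<phi>(1)]]
    by blast
  have left: "?\<psi> v = u" if "u \<in> I" "v = \<phi> u" for u v
    using that bij_betw_inv_into_left[OF \<phi>(1)] by blast
  show ?thesis
    unfolding left_ideal_iso_def
  proof (intro exI[of _ ?\<psi>] conjI ballI allI)
    show "bij_betw ?\<psi> J I" by (rule bij_betw_inv_into[OF \<phi>(1)])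
  qed (intro left; use \<psi> \<phi>(2-4) left_idealD(3-5)[OF I] in simp)+
qed

lemma left_ideal_iso_trans:
  assumes "left_ideal_iso A I J" "left_ideal_iso A J L"
  shows "left_ideal_iso A I L"
proof -
  obtain \<phi> where \<phi>: "bij_betw \<phi> I J" "\<And>u v. u \<in> I \<Longrightarrow> v \<in> I \<Longrightarrow> \<phi> (u + v) = \<phi> u + \<phi> v"
    "\<And>c u. u \<in> I \<Longrightarrow> \<phi> (ascale A c u) = ascale A c (\<phi> u)"
    "\<And>a u. a \<in> acarrier A \<Longrightarrow> u \<in> I \<Longrightarrow> \<phi> (amult A a u) = amult A a (\<phi> u)"
    using assms(1) unfolding left_ideal_iso_def by blast
  obtain \<psi> where \<psi>: "bij_betw \<psi> J L" "\<And>u v. u \<in> J \<Longrightarrow> v \<in> J \<Longrightarrow> \<psi> (u + v) = \<psi> u + \<psi> v"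
    "\<And>c u. u \<in> J \<Longrightarrow> \<psi> (ascale A c u) = ascale A c (\<psi> u)"
    "\<And>a u. a \<in> acarrier A \<Longrightarrow> u \<in> J \<Longrightarrow> \<psi> (amult A a u) = amult A a (\<psi> u)"
    using assms(2) unfolding left_ideal_iso_def by blast
  have "\<phi> u \<in> J" if "u \<in> I" for u using bij_betw_apply[OF \<phi>(1) that] .
  then show ?thesis
    unfolding left_ideal_iso_def
    using bij_betw_trans[OF \<phi>(1) \<psi>(1)] \<phi>(2-4) \<psi>(2-4)
    by (intro exI[of _ "\<psi> \<circ> \<phi>"]) simp
qed

text \<open>Images of left ideals under an isomorphism are left ideals, so proper ones can be transported.\<close>
lemma minimal_left_ideal_iso:
  assumes J: "left_ideal A J" and iso: "left_ideal_iso A J I" and I: "minimal_left_ideal A I"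
  shows "minimal_left_ideal A J"
proof -
  obtain \<phi> where \<phi>: "bij_betw \<phi> J I" "\<And>u v. u \<in> J \<Longrightarrow> v \<in> J \<Longrightarrow> \<phi> (u + v) = \<phi> u + \<phi> v"
    "\<And>c u. u \<in> J \<Longrightarrow> \<phi> (ascale A c u) = ascale A c (\<phi> u)"
    "\<And>a u. a \<in> acarrier A \<Longrightarrow> u \<in> J \<Longrightarrow> \<phi> (amult A a u) = amult A a (\<phi> u)"
    using iso unfolding left_ideal_iso_def by blast
  have inj: "inj_on \<phi> J" and img: "\<phi> ` J = I" using \<phi>(1) by (auto simp: bij_betw_def)
  have "\<phi> 0 + \<phi> 0 = \<phi> 0"
    using \<phi>(2)[of 0 0] left_idealD(2)[OF J] by simp
  then have \<phi>0: "\<phi> 0 = 0" by simp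
  show ?thesis
    unfolding minimal_left_ideal_def
  proof (intro conjI allI impI J)
    show "J \<noteq> {0}"
      using img \<phi>0 minimal_left_idealD(2)[OF I] by auto
  next
    fix L assume "left_ideal A L \<and> L \<subseteq> J"
    then have L: "left_ideal A L" "L \<subseteq> J" by auto
    note Ld = left_idealD[OF L(1)]
    have LJ: "u \<in> J" if "u \<in> L" for u using L(2) that by blast
    have "left_ideal A (\<phi> ` L)"
      unfolding left_ideal_def
    proof (intro conjI ballI allI)
      show "\<phi> ` L \<subseteq> acarrier A"
        using L(2) img left_idealD(1)[OF minimal_left_idealD(1)[OF I]] by blast
      show "0 \<in> \<phi> ` L" using Ld(2) \<phi>0 by (metis image_eqI)
    next
      fix u v assume "u \<in> \<phi> ` L" "v \<in> \<phi> ` L"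
      then obtain u' v' where "u' \<in> L" "v' \<in> L" "u = \<phi> u'" "v = \<phi> v'" by blast
      then show "u + v \<in> \<phi> ` L" using Ld(3) \<phi>(2)[OF LJ LJ] by (metis image_eqI)
    next
      fix c u assume "u \<in> \<phi> ` L"
      then obtain u' where "u' \<in> L" "u = \<phi> u'" by blast
      then show "ascale A c u \<in> \<phi> ` L" using Ld(4) \<phi>(3)[OF LJ] by (metis image_eqI)
    next
      fix a u assume "a \<in> acarrier A" "u \<in> \<phi> ` L"
      then obtain u' where "u' \<in> L" "u = \<phi> u'" by blast
      then show "amult A a u \<in> \<phi> ` L"
        using Ld(5) \<phi>(4)[OF _ LJ] \<open>a \<in> acarrier A\<close> by (metis image_eqI)
    qed
    moreover have "\<phi> ` L \<subseteq> I" using L(2) img by blast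
    ultimately consider "\<phi> ` L = {0}" | "\<phi> ` L = \<phi> ` J"
      using minimal_left_idealD(3)[OF I] img by blast
    then show "L = {0} \<or> L = J"
    proof cases
      case 1
      then have "\<phi> u = \<phi> 0" if "u \<in> L" for u using that \<phi>0 by auto
      then have "u = 0" if "u \<in> L" for u
        using that inj_onD[OF inj] LJ left_idealD(2)[OF J] by blast
      then show ?thesis using Ld(2) by blast
    next
      case 2
      then show ?thesis using inj_on_image_eq_iff[OF inj L(2)] by blast
    qed
  qed
qed

section \<open>The Steinberg algebra\<close>

context ample_hausdorff_groupoid
begin

abbreviation steinberg_carrier where "steinberg_carrier \<equiv> acarrier (steinberg_algebra G)"

lemma steinberg_carrier_iff:
  "f \<in> steinberg_carrier \<longleftrightarrow> (\<forall>a. a \<notin> gcarrier G \<longrightarrow> f a = 0) \<and>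
     locally_constant (gtop G) f \<and> compactin (gtop G) {a \<in> gcarrier G. f a \<noteq> 0}"
  by (simp add: steinberg_algebra_def)

lemma steinberg_outside: "f \<in> steinberg_carrier \<Longrightarrow> a \<notin> gcarrier G \<Longrightarrow> f a = 0"
  by (simp add: steinberg_carrier_iff)

lemma steinberg_support_in_carrier: "f \<in> steinberg_carrier \<Longrightarrow> f a \<noteq> 0 \<Longrightarrow> a \<in> gcarrier G"
  using steinberg_outside by blast

lemma steinberg_fibre_finite:
  assumes "f \<in> steinberg_carrier"
  shows "finite {d \<in> gcarrier G. grange G d = x \<and> f d \<noteq> 0}"
    "finite {d \<in> gcarrier G. gsource G d = x \<and> f d \<noteq> 0}"
proof -
  have "compactin (gtop G) {a \<in> gcarrier G. f a \<noteq> 0}"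
    using assms by (simp add: steinberg_carrier_iff)
  from compact_fibre_finite[OF this, of x]
  show "finite {d \<in> gcarrier G. grange G d = x \<and> f d \<noteq> 0}"
    "finite {d \<in> gcarrier G. gsource G d = x \<and> f d \<noteq> 0}"
    by (simp_all add: conj_ac)
qed

lemma steinberg_assoc:
  "f \<in> steinberg_carrier \<Longrightarrow> h \<in> steinberg_carrier \<Longrightarrow> (f \<star> g) \<star> h = f \<star> (g \<star> h)"
  by (intro convolution_assoc steinberg_fibre_finite)

lemma convolution_zero_right [simp]: "f \<star> 0 = 0"
  and convolution_zero_left [simp]: "0 \<star> f = 0"
  by (auto simp: convolution_def fun_eq_iff)

text \<open>All functions in the algebra vanish off the groupoid, and so does every convolution; identities
  therefore need checking on the groupoid only.\<close>
lemma convolution_eqI: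
  assumes "\<And>c. c \<in> gcarrier G \<Longrightarrow> (f \<star> g) c = h c" "\<And>c. c \<notin> gcarrier G \<Longrightarrow> h c = 0"
  shows "f \<star> g = h"
  using assms convolution_outside by (metis ext)

lemma convolution_distrib_left:
  assumes a: "a \<in> steinberg_carrier"
  shows "a \<star> (u + v) = a \<star> u + a \<star> v"
proof (rule convolution_eqI)
  fix c assume "c \<in> gcarrier G"
  then have "(a \<star> w) c = (\<Sum>d\<in>{d \<in> gcarrier G. grange G d = grange G c \<and> a d \<noteq> 0}.
      a d * w (ginv G d \<cdot> c))" for w
    by (intro convolution_range_sum steinberg_fibre_finite a) auto
  then show "(a \<star> (u + v)) c = (a \<star> u + a \<star> v) c"
    by (simp add: distrib_left sum.distrib)
qed (simp add: convolution_outside)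

lemma convolution_distrib_right:
  assumes a: "a \<in> steinberg_carrier"
  shows "(u + v) \<star> a = u \<star> a + v \<star> a"
proof (rule convolution_eqI)
  fix c assume "c \<in> gcarrier G"
  then have "(w \<star> a) c = (\<Sum>d\<in>{d \<in> gcarrier G. gsource G d = gsource G c \<and> a d \<noteq> 0}.
      w (c \<cdot> ginv G d) * a d)" for w
    by (intro convolution_source_sum steinberg_fibre_finite a) auto
  then show "((u + v) \<star> a) c = (u \<star> a + v \<star> a) c"
    by (simp add: distrib_right sum.distrib)
qed (simp add: convolution_outside)

lemma convolution_scale_right:
  assumes a: "a \<in> steinberg_carrier"
  shows "a \<star> (\<lambda>x. k * u x) = (\<lambda>c. k * (a \<star> u) c)"
proof (rule convolution_eqI)
  fix c assume "c \<in> gcarrier G"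
  then have "(a \<star> w) c = (\<Sum>d\<in>{d \<in> gcarrier G. grange G d = grange G c \<and> a d \<noteq> 0}.
      a d * w (ginv G d \<cdot> c))" for w
    by (intro convolution_range_sum steinberg_fibre_finite a) auto
  then show "(a \<star> (\<lambda>x. k * u x)) c = k * (a \<star> u) c"
    by (simp add: sum_distrib_left mult_ac)
qed (simp add: convolution_outside)

lemma convolution_scale_left:
  assumes a: "a \<in> steinberg_carrier"
  shows "(\<lambda>x. k * u x) \<star> a = (\<lambda>c. k * (u \<star> a) c)"
proof (rule convolution_eqI)
  fix c assume "c \<in> gcarrier G"
  then have "(w \<star> a) c = (\<Sum>d\<in>{d \<in> gcarrier G. gsource G d = gsource G c \<and> a d \<noteq> 0}.
      w (c \<cdot> ginv G d) * a d)" for w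
    by (intro convolution_source_sum steinberg_fibre_finite a) auto
  then show "((\<lambda>x. k * u x) \<star> a) c = k * (u \<star> a) c"
    by (simp add: sum_distrib_left mult_ac)
qed (simp add: convolution_outside)

lemma indicator_in_steinberg:
  assumes "openin (gtop G) W" "compactin (gtop G) W"
  shows "(indicator W :: 'g \<Rightarrow> 'k::field) \<in> steinberg_carrier"
proof -
  let ?w = "indicator W :: 'g \<Rightarrow> 'k"
  have W: "W \<subseteq> gcarrier G" using openin_subset[OF assms(1)] .
  have "openin (gtop G) (gcarrier G - W)"
    using compactin_imp_closedin[OF hausdorff assms(2)] by blast
  then have "\<exists>U. openin (gtop G) U \<and> a \<in> U \<and> (\<forall>b\<in>U. ?w b = ?w a)"
    if "a \<in> gcarrier G" for a
  proof (intro exI conjI ballI)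
    let ?U = "if a \<in> W then W else gcarrier G - W"
    show "openin (gtop G) ?U" using assms(1) \<open>openin (gtop G) (gcarrier G - W)\<close> by simp
    show "a \<in> ?U" using that by simp
    show "?w b = ?w a" if "b \<in> ?U" for b
      using that by (auto simp: indicator_def split: if_splits)
  qed
  moreover have "{a \<in> gcarrier G. ?w a \<noteq> 0} = W"
    using W by (auto simp: indicator_def)
  moreover have "?w a = 0" if "a \<notin> gcarrier G" for a
    using that W by (auto simp: indicator_def)
  ultimately show ?thesis
    using assms(2) unfolding steinberg_carrier_iff locally_constant_def by simp
qed

text \<open>This is the linear span of the point masses at isolated points. It turns out to be a two-sided
  ideal of the Steinberg algebra that contains every minimal left ideal.\<close>
definition isolated_functions :: "('g \<Rightarrow> 'k::field) set" where
  "isolated_functions =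
     {f. finite {a. f a \<noteq> 0} \<and> (\<forall>a. f a \<noteq> 0 \<longrightarrow> openin (gtop G) {a})}"

lemma isolated_functions_zero: "0 \<in> isolated_functions"
  by (simp add: isolated_functions_def)

lemma isolated_functions_add:
  assumes "u \<in> isolated_functions" "v \<in> isolated_functions"
  shows "u + v \<in> isolated_functions"
proof -
  have sub: "{c. (u + v) c \<noteq> 0} \<subseteq> {c. u c \<noteq> 0} \<union> {c. v c \<noteq> 0}" by auto
  moreover have "finite ({c. u c \<noteq> 0} \<union> {c. v c \<noteq> 0})"
    using assms by (simp add: isolated_functions_def)
  ultimately have "finite {c. (u + v) c \<noteq> 0}" by (rule finite_subset)
  moreover have "openin (gtop G) {c}" if "(u + v) c \<noteq> 0" for c
    using sub that assms unfolding isolated_functions_def by blast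
  ultimately show ?thesis by (simp add: isolated_functions_def)
qed

lemma isolated_functions_scale:
  assumes "u \<in> isolated_functions"
  shows "(\<lambda>c. k * u c) \<in> isolated_functions"
proof -
  have "{c. k * u c \<noteq> 0} \<subseteq> {c. u c \<noteq> 0}" by auto
  moreover have "finite {c. u c \<noteq> 0}"
    using assms by (simp add: isolated_functions_def)
  ultimately have "finite {c. k * u c \<noteq> 0}" by (rule finite_subset)
  then show ?thesis using assms by (simp add: isolated_functions_def)
qed

lemma isolated_functions_subset: "isolated_functions \<subseteq> steinberg_carrier"
proof
  fix f :: "'g \<Rightarrow> 'k::field" assume "f \<in> isolated_functions"
  then have f: "finite {a. f a \<noteq> 0}" "\<And>a. f a \<noteq> 0 \<Longrightarrow> openin (gtop G) {a}"
    by (auto simp: isolated_functions_def)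
  then have carrier: "{a. f a \<noteq> 0} \<subseteq> gcarrier G" using openin_subset by blast
  have "closedin (gtop G) {a. f a \<noteq> 0}"
    using t1_space_closedin_finite Hausdorff_imp_t1_space[OF hausdorff] f(1) carrier by blast
  then have "openin (gtop G) (gcarrier G - {a. f a \<noteq> 0})" by blast
  then have "\<exists>U. openin (gtop G) U \<and> a \<in> U \<and> (\<forall>b\<in>U. f b = f a)" if "a \<in> gcarrier G" for a
  proof (intro exI conjI ballI)
    let ?U = "if f a = 0 then gcarrier G - {a. f a \<noteq> 0} else {a}"
    show "openin (gtop G) ?U"
      using f(2) \<open>openin (gtop G) (gcarrier G - {a. f a \<noteq> 0})\<close> by simp
    show "a \<in> ?U" using that by simp
    show "f b = f a" if "b \<in> ?U" for b using that by (auto split: if_splits)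
  qed
  moreover have "{a \<in> gcarrier G. f a \<noteq> 0} = {a. f a \<noteq> 0}" using carrier by blast
  ultimately show "f \<in> steinberg_carrier"
    using f(1) carrier by (auto simp: steinberg_carrier_iff locally_constant_def finite_imp_compactin)
qed

text \<open>The support of a locally constant function is open; removing all but one of its finitely many
  points, a closed set, leaves that point open.\<close>
lemma finite_support_isolated:
  assumes f: "f \<in> steinberg_carrier" "finite {a. f a \<noteq> 0}"
  shows "f \<in> isolated_functions"
proof -
  have "openin (gtop G) {a}" if a: "f a \<noteq> 0" for a
  proof -
    obtain U where U: "openin (gtop G) U" "a \<in> U" "\<And>b. b \<in> U \<Longrightarrow> f b = f a"
      using f(1) steinberg_support_in_carrier[OF f(1) a]
      unfolding steinberg_carrier_iff locally_constant_def by blast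
    have "finite ({a. f a \<noteq> 0} - {a})" "{a. f a \<noteq> 0} - {a} \<subseteq> gcarrier G"
      using f steinberg_support_in_carrier[OF f(1)] by auto
    then have "closedin (gtop G) ({a. f a \<noteq> 0} - {a})"
      using t1_space_closedin_finite Hausdorff_imp_t1_space[OF hausdorff] by blast
    then have "openin (gtop G) (U - ({a. f a \<noteq> 0} - {a}))"
      using U(1) by blast
    moreover have "f b \<noteq> 0" if "b \<in> U" for b using U(3)[OF that] a by simp
    then have "U - ({a. f a \<noteq> 0} - {a}) = {a}" using U(2) by blast
    ultimately show ?thesis by simp
  qed
  then show ?thesis using f(2) by (simp add: isolated_functions_def)
qed

lemma indicator_isolated: "openin (gtop G) {a} \<Longrightarrow> indicator {a} \<in> isolated_functions"
  by (auto simp: isolated_functions_def indicator_def)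

lemma isolated_mult:
  assumes "a \<in> gcarrier G" "b \<in> gcarrier G" "gsource G a = grange G b"
    and "openin (gtop G) {b}"
  shows "openin (gtop G) {a \<cdot> b}"
  using assms isolated_source_iff[of b] isolated_source_iff[of "a \<cdot> b"] by simp

lemma isolated_mult':
  assumes "a \<in> gcarrier G" "b \<in> gcarrier G" "gsource G a = grange G b"
    and "openin (gtop G) {a}"
  shows "openin (gtop G) {a \<cdot> b}"
  using assms isolated_range_iff[of a] isolated_range_iff[of "a \<cdot> b"] by simp

text \<open>A point mass at \<open>b\<close> meets \<open>a\<close> only in the source fibre over \<open>r b\<close>, where \<open>a\<close> has finite support.\<close>
lemma steinberg_convolution_isolated:
  assumes a: "a \<in> steinberg_carrier" and f: "f \<in> isolated_functions"
  shows "a \<star> f \<in> isolated_functions"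
proof -
  let ?S = "\<Union>b\<in>{b. f b \<noteq> 0}. (\<lambda>d. d \<cdot> b) `
      {d \<in> gcarrier G. gsource G d = grange G b \<and> a d \<noteq> 0}"
  have "finite ?S"
    using f steinberg_fibre_finite(2)[OF a] by (simp add: isolated_functions_def)
  moreover have "{c. (a \<star> f) c \<noteq> 0} \<subseteq> ?S"
    by (auto elim!: convolution_supportE)
  moreover have "openin (gtop G) {c}" if "(a \<star> f) c \<noteq> 0" for c
    using that f
    by (elim convolution_supportE) (auto simp: isolated_functions_def intro: isolated_mult)
  ultimately show ?thesis by (auto simp: isolated_functions_def intro: finite_subset)
qed

lemma isolated_convolution_steinberg:
  assumes f: "f \<in> isolated_functions" and a: "a \<in> steinberg_carrier"
  shows "f \<star> a \<in> isolated_functions"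
proof -
  let ?S = "\<Union>b\<in>{b. f b \<noteq> 0}. (\<lambda>d. b \<cdot> d) `
      {d \<in> gcarrier G. grange G d = gsource G b \<and> a d \<noteq> 0}"
  have "finite ?S"
    using f steinberg_fibre_finite(1)[OF a] by (simp add: isolated_functions_def)
  moreover have "{c. (f \<star> a) c \<noteq> 0} \<subseteq> ?S"
    by (auto elim!: convolution_supportE)
  moreover have "openin (gtop G) {c}" if "(f \<star> a) c \<noteq> 0" for c
    using that f
    by (elim convolution_supportE) (auto simp: isolated_functions_def intro: isolated_mult')
  ultimately show ?thesis by (auto simp: isolated_functions_def intro: finite_subset)
qed

section \<open>Minimal left ideals consist of functions supported on finitely many isolated points\<close>

lemma right_mult_zero_or_injective:
  assumes I: "minimal_left_ideal (steinberg_algebra G) I" and a: "a \<in> steinberg_carrier"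
  shows "(\<forall>u\<in>I. u \<star> a = 0) \<or> (\<forall>u\<in>I. u \<star> a = 0 \<longrightarrow> u = 0)"
proof -
  note Id = left_idealD[OF minimal_left_idealD(1)[OF I], unfolded amult_steinberg ascale_steinberg]
  have "left_ideal (steinberg_algebra G) {u \<in> I. u \<star> a = 0}"
    unfolding left_ideal_def amult_steinberg ascale_steinberg
    using Id a
    by (auto simp: convolution_distrib_right convolution_scale_left steinberg_assoc zero_fun_def[symmetric])
  from minimal_left_idealD(3)[OF I this] show ?thesis by blast
qed

text \<open>Fix a source \<open>y\<close> of the support of \<open>f\<close> and suppose a range \<open>z\<close> of the support is not the range
  of any support point with source \<open>y\<close>. The sources of the support points over \<open>z\<close> form a finite
  set missing \<open>y\<close>, so some neighbourhood \<open>W\<close> of \<open>y\<close> avoids it; then \<open>z\<close> is outside the compact set of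
  ranges of \<open>f 1\<^sub>W\<close>, and some neighbourhood \<open>V\<close> of \<open>z\<close> gives \<open>1\<^sub>V f 1\<^sub>W = 0\<close> although \<open>1\<^sub>V f \<noteq> 0\<close> and
  \<open>f 1\<^sub>W \<noteq> 0\<close>. This contradicts \<open>right_mult_zero_or_injective\<close>. So all support points lie over
  finitely many ranges.\<close>
lemma minimal_left_ideal_isolated:
  fixes f :: "'g \<Rightarrow> 'k::field"
  assumes I: "minimal_left_ideal (steinberg_algebra G) I" and f: "f \<in> I"
  shows "f \<in> isolated_functions"
proof (rule finite_support_isolated)
  note Id = left_idealD[OF minimal_left_idealD(1)[OF I], unfolded amult_steinberg ascale_steinberg]
  show fA: "f \<in> steinberg_carrier" using Id(1) f by blast
  have fC: "a \<in> gcarrier G" if "f a \<noteq> 0" for a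
    using that steinberg_outside[OF fA] by blast
  show "finite {a. f a \<noteq> 0}"
  proof (cases "\<exists>c. f c \<noteq> 0")
    case True
    then obtain c where c: "f c \<noteq> 0" "c \<in> gcarrier G" using fC by blast
    define y where "y = gsource G c"
    let ?Y = "{d \<in> gcarrier G. gsource G d = y \<and> f d \<noteq> 0}"
    have ranges: "grange G a \<in> grange G ` ?Y" if a: "f a \<noteq> 0" for a
    proof (rule ccontr)
      assume no: "grange G a \<notin> grange G ` ?Y"
      define z where "z = grange G a"
      let ?D = "gsource G ` {d \<in> gcarrier G. grange G d = z \<and> f d \<noteq> 0}"
      have aC: "a \<in> gcarrier G" using fC a .
      have "finite ?D" "?D \<subseteq> gcarrier G"
        using steinberg_fibre_finite(1)[OF fA] by auto
      then have "closedin (gtop G) ?D"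
        using t1_space_closedin_finite Hausdorff_imp_t1_space[OF hausdorff] by blast
      then have "openin (gtop G) (gcarrier G - ?D)" by blast
      moreover have "y \<in> gcarrier G - ?D"
      proof -
        have "y \<notin> ?D"
        proof
          assume "y \<in> ?D"
          then obtain d where "d \<in> ?Y" "grange G d = z" by auto
          then show False using no unfolding z_def by (metis (no_types, lifting) image_eqI)
        qed
        then show ?thesis using c(2) by (simp add: y_def)
      qed
      ultimately obtain W where W: "openin (gtop G) W" "compactin (gtop G) W"
        "W \<subseteq> unit_space G" "y \<in> W" "W \<subseteq> gcarrier G - ?D"
        using unit_neighbourhood[of y "gcarrier G - ?D"] c(2) by (auto simp: y_def)
      let ?S = "{d \<in> gcarrier G. gsource G d \<in> W} \<inter> {d \<in> gcarrier G. f d \<noteq> 0}"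
      have "compactin (gtop G) ?S"
        using fA compactin_imp_closedin[OF hausdorff W(2)]
        by (intro closed_Int_compactin closedin_continuous_map_preimage[OF continuous_source])
          (auto simp: steinberg_carrier_iff)
      then have "closedin (gtop G) (grange G ` ?S)"
        by (intro compactin_imp_closedin[OF hausdorff] image_compactin[OF _ continuous_range])
      then have "openin (gtop G) (gcarrier G - grange G ` ?S)" by blast
      moreover have "z \<in> gcarrier G - grange G ` ?S"
        using W(5) aC by (auto simp: z_def)
      ultimately obtain V where V: "openin (gtop G) V" "compactin (gtop G) V"
        "V \<subseteq> unit_space G" "z \<in> V" "V \<subseteq> gcarrier G - grange G ` ?S"
        using unit_neighbourhood[of z "gcarrier G - grange G ` ?S"] aC by (auto simp: z_def)
      have wA: "(indicator W :: 'g \<Rightarrow> 'k) \<in> steinberg_carrier"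
        and vA: "(indicator V :: 'g \<Rightarrow> 'k) \<in> steinberg_carrier"
        using indicator_in_steinberg W V by blast+
      have "(f \<star> indicator W) c \<noteq> 0"
        using W(3,4) c by (simp add: convolution_units_right y_def)
      then have "f \<star> indicator W \<noteq> 0" by auto
      then have inj: "u = 0" if "u \<in> I" "u \<star> indicator W = 0" for u
        using right_mult_zero_or_injective[OF I wA] f that by blast
      have "indicator V \<star> f = 0"
      proof (rule inj)
        show "indicator V \<star> f \<in> I" using Id(5) vA f .
        show "(indicator V \<star> f) \<star> indicator W = 0"
        proof (rule convolution_eqI)
          fix d assume "d \<in> gcarrier G"
          then show "((indicator V \<star> f) \<star> indicator W) d = 0 d"
            using V(3,5) W(3) by (auto simp: convolution_units_left convolution_units_right)
        qed simp
      qed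
      moreover have "(indicator V \<star> f) a = f a"
        using V(3,4) aC by (simp add: convolution_units_left z_def)
      ultimately show False using a by simp
    qed
    let ?C = "\<lambda>z. {d \<in> gcarrier G. grange G d = z \<and> f d \<noteq> 0}"
    have "{a. f a \<noteq> 0} \<subseteq> (\<Union>z\<in>grange G ` ?Y. ?C z)"
    proof
      fix a assume "a \<in> {a. f a \<noteq> 0}"
      then show "a \<in> (\<Union>z\<in>grange G ` ?Y. ?C z)"
        using ranges[of a] fC[of a] by (intro UN_I[of "grange G a"]) simp_all
    qed
    moreover have "finite (\<Union>z\<in>grange G ` ?Y. ?C z)"
      by (intro finite_UN_I finite_imageI steinberg_fibre_finite[OF fA])
    ultimately show ?thesis by (rule finite_subset)
  qed simp
qed

section \<open>Isotropy groups of sources\<close>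

lemma isotropy_algebra_carrier:
  "u \<in> acarrier (steinberg_algebra (isotropy_group G x)) \<longleftrightarrow>
     (\<forall>a. a \<notin> isotropy G x \<longrightarrow> u a = 0) \<and> finite {a. u a \<noteq> 0}"
proof -
  have "{a \<in> isotropy G x. u a \<noteq> 0} = {a. u a \<noteq> 0}" if "\<forall>a. a \<notin> isotropy G x \<longrightarrow> u a = 0"
    using that by blast
  then show ?thesis
    by (auto simp: steinberg_algebra_def isotropy_group_def locally_constant_def
        compactin_discrete_topology intro!: exI[of _ "{_}"])
qed

text \<open>Elements of the group algebra are functions on the whole type that vanish off the isotropy group,
  so the factorisations with nonzero factors are the same in the group and in the groupoid.\<close>
lemma isotropy_algebra_convolution:
  assumes "\<And>a. a \<notin> isotropy G x \<Longrightarrow> u a = 0" "\<And>a. a \<notin> isotropy G x \<Longrightarrow> v a = 0"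
  shows "convolution (isotropy_group G x) u v = u \<star> v"
proof
  fix c
  have "{(a, b) \<in> comp_pairs (isotropy_group G x). gmult (isotropy_group G x) a b = c \<and> u a \<noteq> 0 \<and> v b \<noteq> 0}
      = {(a, b) \<in> comp_pairs G. a \<cdot> b = c \<and> u a \<noteq> 0 \<and> v b \<noteq> 0}"
    using assms by (fastforce simp: isotropy_group_def comp_pairs_iff isotropy_def)
  then show "convolution (isotropy_group G x) u v c = (u \<star> v) c"
    by (simp add: convolution_def)
qed

lemma isotropy_algebra_subset:
  assumes "openin (gtop G) {x}"
  shows "acarrier (steinberg_algebra (isotropy_group G x)) \<subseteq> isolated_functions"
proof
  fix u :: "'g \<Rightarrow> 'k::field" assume u: "u \<in> acarrier (steinberg_algebra (isotropy_group G x))"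
  have "openin (gtop G) {a}" if "u a \<noteq> 0" for a
  proof -
    have "a \<in> isotropy G x" using u that by (auto simp: isotropy_algebra_carrier)
    then show ?thesis using assms isolated_range_iff[of a] by (simp add: isotropy_def)
  qed
  then show "u \<in> isolated_functions"
    using u by (auto simp: isotropy_algebra_carrier isolated_functions_def)
qed

text \<open>The compression of \<open>u\<close> to \<open>e A e\<close> with \<open>e\<close> the point mass at \<open>x\<close>; on functions it is restriction
  to the isotropy group.\<close>
definition corner :: "'g \<Rightarrow> ('g \<Rightarrow> 'k::field) \<Rightarrow> 'g \<Rightarrow> 'k" where
  "corner x u = indicator {x} \<star> (u \<star> indicator {x})"

lemma corner_apply:
  assumes "x \<in> unit_space G"
  shows "corner x u c = (if c \<in> isotropy G x then u c else 0)"
  using assms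
  by (cases "c \<in> gcarrier G")
    (auto simp: corner_def convolution_outside convolution_units_left convolution_units_right
      isotropy_def)

lemma corner_isotropy_algebra:
  assumes x: "x \<in> unit_space G" and u: "u \<in> isolated_functions"
  shows "corner x u \<in> acarrier (steinberg_algebra (isotropy_group G x))"
proof -
  have "{a. corner x u a \<noteq> 0} \<subseteq> {a. u a \<noteq> 0}" by (auto simp: corner_apply[OF x])
  then have "finite {a. corner x u a \<noteq> 0}"
    using u by (auto simp: isolated_functions_def intro: finite_subset)
  moreover have "corner x u a = 0" if "a \<notin> isotropy G x" for a
    using that by (simp add: corner_apply[OF x])
  ultimately show ?thesis by (simp add: isotropy_algebra_carrier)
qed

text \<open>Compression is multiplicative once the inner idempotent is inserted:
  \<open>e (b e u) e = (e b e) (e u e)\<close>.\<close>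
lemma corner_convolution:
  fixes u :: "'g \<Rightarrow> 'k::field"
  assumes x: "x \<in> unit_space G" "openin (gtop G) {x}"
    and b: "b \<in> isolated_functions" and u: "u \<in> steinberg_carrier"
  shows "corner x (b \<star> (indicator {x} \<star> u)) = corner x b \<star> corner x u"
proof -
  let ?e = "indicator {x} :: 'g \<Rightarrow> 'k"
  have e: "?e \<in> isolated_functions" by (rule indicator_isolated[OF x(2)])
  have A: "v \<in> steinberg_carrier" if "v \<in> isolated_functions" for v :: "'g \<Rightarrow> 'k"
    using that isolated_functions_subset by blast
  have idem: "?e \<star> (?e \<star> v) = ?e \<star> v" for v :: "'g \<Rightarrow> 'k"
    using x(1) by (intro convolution_eqI)
      (simp_all add: convolution_units_left convolution_outside)
  have ue: "?e \<star> (u \<star> ?e) \<in> isolated_functions"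
    by (intro isolated_convolution_steinberg e A steinberg_convolution_isolated u)
  have "corner x b \<star> corner x u = ?e \<star> (b \<star> (?e \<star> (?e \<star> (u \<star> ?e))))"
    unfolding corner_def using A[OF e] A[OF ue] A[OF b] by (simp add: steinberg_assoc)
  also have "\<dots> = corner x (b \<star> (?e \<star> u))"
    unfolding corner_def idem using A[OF e] A[OF b] by (simp add: steinberg_assoc)
  finally show ?thesis by simp
qed

text \<open>Let \<open>J\<close> be a left ideal of \<open>e A e\<close> inside \<open>e I e\<close> with a nonzero element \<open>e u e\<close>. The elements
  \<open>v\<close> of \<open>I\<close> with \<open>e b v e \<in> J\<close> for all \<open>b\<close> form a left ideal \<open>Q\<close> of \<open>A\<close>. It contains \<open>e u\<close>, which is
  nonzero, so \<open>Q = I\<close> by minimality, and \<open>b = e\<close> yields \<open>e I e \<subseteq> J\<close>. Letting \<open>b\<close> range over the ideal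
  of functions supported on finitely many isolated points is enough, because this ideal
  contains \<open>e\<close> and absorbs the multipliers \<open>a\<close> in \<open>b (a v) = (b a) v\<close>.\<close>
lemma corner_minimal:
  fixes I :: "('g \<Rightarrow> 'k::field) set"
  assumes I: "minimal_left_ideal (steinberg_algebra G) I"
    and y: "y \<in> unit_space G" "openin (gtop G) {y}"
    and nz: "\<exists>u\<in>I. corner y u \<noteq> 0"
  shows "minimal_left_ideal (steinberg_algebra (isotropy_group G y)) (corner y ` I)"
proof -
  note Id = left_idealD[OF minimal_left_idealD(1)[OF I], unfolded amult_steinberg ascale_steinberg]
  let ?B = "steinberg_algebra (isotropy_group G y) :: ('k, 'g \<Rightarrow> 'k) algebra_data"
  let ?e = "indicator {y} :: 'g \<Rightarrow> 'k"
  have e: "?e \<in> isolated_functions" by (rule indicator_isolated[OF y(2)])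
  have A: "v \<in> steinberg_carrier" if "v \<in> isolated_functions" for v :: "'g \<Rightarrow> 'k"
    using that isolated_functions_subset by blast
  have IF: "u \<in> isolated_functions" if "u \<in> I" for u
    using minimal_left_ideal_isolated[OF I that] .
  have add: "corner y (u + v) = corner y u + corner y v" for u v :: "'g \<Rightarrow> 'k"
    by (auto simp: fun_eq_iff corner_apply[OF y(1)])
  have scale: "corner y (\<lambda>a. k * u a) = (\<lambda>a. k * corner y u a)" for k and u :: "'g \<Rightarrow> 'k"
    by (auto simp: fun_eq_iff corner_apply[OF y(1)])
  have zero: "corner y 0 = (0 :: 'g \<Rightarrow> 'k)"
    by (auto simp: fun_eq_iff corner_apply[OF y(1)])
  have corner_e: "corner y (?e \<star> u) = corner y u" for u
    using y(1) by (auto simp: fun_eq_iff corner_apply convolution_units_left isotropy_def)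
  have corner_id: "corner y h = h" if "h \<in> acarrier ?B" for h
    using that by (auto simp: fun_eq_iff corner_apply[OF y(1)] isotropy_algebra_carrier)
  have conv: "convolution (isotropy_group G y) h (corner y u) = corner y (h \<star> (?e \<star> u))"
    if "h \<in> acarrier ?B" "u \<in> I" for h u
  proof -
    have "convolution (isotropy_group G y) h (corner y u) = h \<star> corner y u"
      using that(1) by (intro isotropy_algebra_convolution)
        (auto simp: isotropy_algebra_carrier corner_apply[OF y(1)])
    also have "\<dots> = corner y h \<star> corner y u" using corner_id[OF that(1)] by simp
    finally show ?thesis
      using corner_convolution[OF y, of h u] isotropy_algebra_subset[OF y(2)] that(1) IF[OF that(2)] A
      by auto
  qed
  have L: "left_ideal ?B (corner y ` I)"
    unfolding left_ideal_def amult_steinberg ascale_steinberg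
  proof (intro conjI ballI allI)
    show "corner y ` I \<subseteq> acarrier ?B"
      using corner_isotropy_algebra[OF y(1)] IF by blast
    show "0 \<in> corner y ` I" using Id(2) zero by (metis image_eqI)
  next
    fix u v assume "u \<in> corner y ` I" "v \<in> corner y ` I"
    then obtain u' v' where "u' \<in> I" "v' \<in> I" "u = corner y u'" "v = corner y v'" by blast
    then show "u + v \<in> corner y ` I" using Id(3)[of u' v'] by (simp add: add[symmetric])
  next
    fix k u assume "u \<in> corner y ` I"
    then obtain u' where "u' \<in> I" "u = corner y u'" by blast
    then show "(\<lambda>a. k * u a) \<in> corner y ` I" using Id(4)[of u'] by (simp add: scale[symmetric])
  next
    fix h u assume h: "h \<in> acarrier ?B" and "u \<in> corner y ` I"
    then obtain u' where u': "u' \<in> I" "u = corner y u'" by blast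
    have "h \<star> (?e \<star> u') \<in> I"
      using h isotropy_algebra_subset[OF y(2)] A e u'(1) by (intro Id(5)) auto
    then show "convolution (isotropy_group G y) h u \<in> corner y ` I"
      using conv[OF h u'(1)] u'(2) by blast
  qed
  show ?thesis
    unfolding minimal_left_ideal_def
  proof (intro conjI allI impI L)
    show "corner y ` I \<noteq> {0}" using nz by blast
  next
    fix J assume J: "left_ideal ?B J \<and> J \<subseteq> corner y ` I"
    note Jd = left_idealD[OF conjunct1[OF J], unfolded amult_steinberg ascale_steinberg]
    show "J = {0} \<or> J = corner y ` I"
    proof (cases "\<exists>h\<in>J. h \<noteq> 0")
      case False
      then show ?thesis using Jd(2) by blast
    next
      case True
      then obtain u0 where u0: "u0 \<in> I" "corner y u0 \<in> J" "corner y u0 \<noteq> 0"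
        using J by blast
      let ?Q = "{v \<in> I. \<forall>b\<in>isolated_functions. corner y (b \<star> v) \<in> J}"
      have "left_ideal (steinberg_algebra G) ?Q"
        unfolding left_ideal_def amult_steinberg ascale_steinberg
      proof (intro conjI ballI allI)
        show "?Q \<subseteq> steinberg_carrier" using Id(1) by blast
        show "0 \<in> ?Q" using Id(2) Jd(2) zero by simp
      next
        fix u v assume "u \<in> ?Q" "v \<in> ?Q"
        then show "u + v \<in> ?Q"
          using Id(3) Jd(3) A by (simp add: convolution_distrib_left add)
      next
        fix k u assume "u \<in> ?Q"
        then show "(\<lambda>a. k * u a) \<in> ?Q"
          using Id(4) Jd(4) A by (simp add: convolution_scale_right scale)
      next
        fix a u :: "'g \<Rightarrow> 'k" assume a: "a \<in> steinberg_carrier" and u: "u \<in> ?Q"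
        have "b \<star> (a \<star> u) = (b \<star> a) \<star> u" if "b \<in> isolated_functions" for b
          using that u Id(1) A by (intro steinberg_assoc[symmetric]) auto
        moreover have "corner y ((b \<star> a) \<star> u) \<in> J" if "b \<in> isolated_functions" for b
          using u isolated_convolution_steinberg[OF that a] by blast
        ultimately show "a \<star> u \<in> ?Q"
          using Id(5)[OF a] u by simp
      qed
      moreover have "?e \<star> u0 \<in> ?Q"
      proof -
        have "corner y (b \<star> (?e \<star> u0)) \<in> J" if b: "b \<in> isolated_functions" for b
        proof -
          have "convolution (isotropy_group G y) (corner y b) (corner y u0) \<in> J"
            using Jd(5) corner_isotropy_algebra[OF y(1) b] u0(2) .
          also have "convolution (isotropy_group G y) (corner y b) (corner y u0)
              = corner y b \<star> corner y u0"
            by (intro isotropy_algebra_convolution) (auto simp: corner_apply[OF y(1)])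
          also have "\<dots> = corner y (b \<star> (?e \<star> u0))"
            using corner_convolution[OF y b] A IF u0(1) by simp
          finally show ?thesis .
        qed
        then show ?thesis using Id(5)[OF A[OF e] u0(1)] by blast
      qed
      moreover have "?e \<star> u0 \<noteq> 0"
        using u0(3) corner_e[of u0] zero by metis
      ultimately have Q: "?Q = I"
        using minimal_left_idealD(3)[OF I, of ?Q] by blast
      have "corner y u \<in> J" if "u \<in> I" for u
      proof -
        have "u \<in> ?Q" unfolding Q by (rule that)
        then have "corner y (?e \<star> u) \<in> J" using e by blast
        then show ?thesis by (simp only: corner_e)
      qed
      then show ?thesis using J by blast
    qed
  qed
qed

text \<open>Left translation by \<open>c\<^sup>-\<^sup>1\<close> moves the value \<open>f c\<close> to the unit \<open>s c\<close>, so the compression of \<open>I\<close> there is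
  nonzero.\<close>
lemma source_of_minimal_left_ideal:
  fixes f :: "'g \<Rightarrow> 'k::field"
  assumes I: "minimal_left_ideal (steinberg_algebra G) I" and f: "f \<in> I" "f c \<noteq> 0"
  shows "openin (gtop G) {gsource G c}"
    and "socle (steinberg_algebra (isotropy_group G (gsource G c)) :: ('k, 'g \<Rightarrow> 'k) algebra_data) \<noteq> {0}"
proof -
  note Id = left_idealD[OF minimal_left_idealD(1)[OF I], unfolded amult_steinberg ascale_steinberg]
  let ?y = "gsource G c"
  have c: "c \<in> gcarrier G" using f Id(1) steinberg_outside by blast
  have isol: "openin (gtop G) {c}"
    using minimal_left_ideal_isolated[OF I f(1)] f(2) by (simp add: isolated_functions_def)
  then show y: "openin (gtop G) {?y}" using isolated_source_iff[OF c] by simp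
  then have "openin (gtop G) {ginv G c}" using isolated_range_iff[of "ginv G c"] c by simp
  then have "(indicator {ginv G c} :: 'g \<Rightarrow> 'k) \<in> steinberg_carrier"
    using indicator_isolated isolated_functions_subset by blast
  then have u: "indicator {ginv G c} \<star> f \<in> I" using Id(5) f(1) by blast
  have "corner ?y (indicator {ginv G c} \<star> f) ?y = f c"
    using c by (simp add: corner_apply convolution_point_mass_left)
  then have nz: "corner ?y (indicator {ginv G c} \<star> f) \<noteq> 0" using f(2) by auto
  then have "minimal_left_ideal (steinberg_algebra (isotropy_group G ?y)) (corner ?y ` I)"
    using u c by (intro corner_minimal[OF I _ y]) auto
  then have "corner ?y ` I \<subseteq> socle (steinberg_algebra (isotropy_group G ?y))"
    unfolding socle_def by (intro subspace_sum_superset) simp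
  then show "socle (steinberg_algebra (isotropy_group G ?y) :: ('k, 'g \<Rightarrow> 'k) algebra_data) \<noteq> {0}"
    using u nz by blast
qed

section \<open>The socle\<close>

text \<open>Such an \<open>f\<close> is the sum of its restrictions \<open>f 1\<^sub>y\<close> to the finitely many sources \<open>y\<close> of its
  support.\<close>
lemma two_sided_ideal_localise:
  fixes f :: "'g \<Rightarrow> 'k::field"
  assumes T: "two_sided_ideal (steinberg_algebra G) T" and f: "f \<in> isolated_functions"
    and units: "\<And>c. f c \<noteq> 0 \<Longrightarrow> indicator {gsource G c} \<in> T"
  shows "f \<in> T"
proof -
  let ?Y = "gsource G ` {c. f c \<noteq> 0}"
  have fA: "f \<in> steinberg_carrier" using f isolated_functions_subset by blast
  have fin: "finite ?Y" using f by (simp add: isolated_functions_def)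
  have "f c = (\<Sum>y\<in>?Y. f \<star> indicator {y}) c" for c
  proof -
    have "(\<Sum>y\<in>?Y. f \<star> indicator {y}) c = (\<Sum>y\<in>?Y. (f \<star> indicator {y}) c)"
      by (induction rule: infinite_finite_induct) auto
    also have "\<dots> = f c"
    proof (cases "f c = 0")
      case True
      have "(f \<star> indicator {y}) c = 0" if "y \<in> ?Y" for y
      proof (cases "c \<in> gcarrier G")
        case c: True
        have "y \<in> unit_space G" using that steinberg_support_in_carrier[OF fA] by auto
        then show ?thesis using True c by (simp add: convolution_units_right)
      qed (simp add: convolution_outside)
      then show ?thesis using True by simp
    next
      case False
      then have c: "c \<in> gcarrier G" using steinberg_outside[OF fA] by blast
      have "(\<Sum>y\<in>?Y. (f \<star> indicator {y}) c) = (\<Sum>y\<in>?Y. if y = gsource G c then f c else 0)"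
      proof (rule sum.cong)
        fix y assume "y \<in> ?Y"
        then have "y \<in> unit_space G" using steinberg_support_in_carrier[OF fA] by auto
        then show "(f \<star> indicator {y}) c = (if y = gsource G c then f c else 0)"
          using c by (simp add: convolution_units_right)
      qed simp
      then show ?thesis using fin False by (simp add: sum.delta)
    qed
    finally show ?thesis by simp
  qed
  then have "f = (\<Sum>y\<in>?Y. f \<star> indicator {y})" by blast
  moreover have "f \<star> indicator {y} \<in> T" if "y \<in> ?Y" for y
    using T that units fA unfolding two_sided_ideal_def left_ideal_def amult_steinberg by blast
  then have "(\<Sum>y\<in>?Y. f \<star> indicator {y}) \<in> T"
    using T by (intro left_ideal_sum[of "steinberg_algebra G"]) (auto simp: two_sided_ideal_def)
  ultimately show ?thesis by simp
qed

lemma principal_left_unit: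
  assumes x: "x \<in> unit_space G" "openin (gtop G) {x}"
  shows "principal_left (steinberg_algebra G) (indicator {x})
    = {u \<in> steinberg_carrier. \<forall>c. u c \<noteq> 0 \<longrightarrow> gsource G c = x}"
proof (intro equalityI subsetI)
  fix u :: "'g \<Rightarrow> 'k::field"
  assume "u \<in> principal_left (steinberg_algebra G) (indicator {x})"
  then obtain a where a: "a \<in> steinberg_carrier" "u = a \<star> indicator {x}"
    by (auto simp: principal_left_def)
  have "u \<in> steinberg_carrier"
    using a steinberg_convolution_isolated[OF a(1) indicator_isolated[OF x(2)]]
      isolated_functions_subset by blast
  moreover have "gsource G c = x" if "u c \<noteq> 0" for c
    using that steinberg_outside[OF calculation] x(1)
    by (cases "c \<in> gcarrier G") (auto simp: a(2) convolution_units_right split: if_splits)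
  ultimately show "u \<in> {u \<in> steinberg_carrier. \<forall>c. u c \<noteq> 0 \<longrightarrow> gsource G c = x}" by blast
next
  fix u :: "'g \<Rightarrow> 'k::field"
  assume u: "u \<in> {u \<in> steinberg_carrier. \<forall>c. u c \<noteq> 0 \<longrightarrow> gsource G c = x}"
  have "u \<star> indicator {x} = u"
    using u x(1) steinberg_outside by (intro convolution_eqI) (auto simp: convolution_units_right)
  then show "u \<in> principal_left (steinberg_algebra G) (indicator {x})"
    using u unfolding principal_left_def amult_steinberg by (metis (no_types, lifting) image_eqI mem_Collect_eq)
qed

lemma indicator_unit_idem:
  assumes "x \<in> unit_space G"
  shows "indicator {x} \<star> indicator {x} = (indicator {x} :: 'g \<Rightarrow> 'k::field)"
proof (rule convolution_eqI)
  fix c assume "c \<in> gcarrier G"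
  then show "(indicator {x} \<star> indicator {x}) c = (indicator {x} c :: 'k)"
    using assms by (auto simp: convolution_units_right indicator_def)
qed (use assms in \<open>auto simp: indicator_def\<close>)

text \<open>If \<open>u\<close> has all sources equal to \<open>x\<close> and \<open>u c \<noteq> 0\<close>, then, with \<open>c'\<close> the inverse of \<open>c\<close>, the
  values of \<open>1\<^bsub>c'\<^esub> u\<close> vanish off the isotropy group at \<open>x\<close>. As that is trivial, the product is \<open>u c\<close> times \<open>1\<^sub>x\<close>, and \<open>u\<close> generates all of \<open>P\<close>.\<close>
lemma principal_left_unit_minimal:
  fixes x
  defines "P \<equiv> principal_left (steinberg_algebra G) (indicator {x} :: 'g \<Rightarrow> 'k::field)"
  assumes x: "x \<in> unit_space G" "openin (gtop G) {x}" and iso: "isotropy G x = {x}"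
  shows "minimal_left_ideal (steinberg_algebra G) P"
proof -
  note P = principal_left_unit[OF x, where 'a = 'k, folded P_def]
  have e: "(indicator {x} :: 'g \<Rightarrow> 'k) \<in> isolated_functions"
    by (rule indicator_isolated[OF x(2)])
  have PF: "P \<subseteq> isolated_functions"
    unfolding P_def principal_left_def using steinberg_convolution_isolated[OF _ e] by auto
  have "left_ideal (steinberg_algebra G) P"
    unfolding left_ideal_def amult_steinberg ascale_steinberg
  proof (intro conjI ballI allI)
    show "P \<subseteq> steinberg_carrier" using P by blast
    show "0 \<in> P"
      using isolated_functions_zero isolated_functions_subset unfolding P by auto
  next
    fix u v assume uv: "u \<in> P" "v \<in> P"
    have "u + v \<in> steinberg_carrier"
      using uv PF isolated_functions_add isolated_functions_subset by blast
    moreover have "gsource G c = x" if "(u + v) c \<noteq> 0" for c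
      using uv that unfolding P by (cases "u c = 0") auto
    ultimately show "u + v \<in> P" unfolding P by blast
  next
    fix k u assume u: "u \<in> P"
    have "(\<lambda>c. k * u c) \<in> steinberg_carrier"
      using u PF isolated_functions_scale isolated_functions_subset by blast
    then show "(\<lambda>c. k * u c) \<in> P" using u unfolding P by auto
  next
    fix a u :: "'g \<Rightarrow> 'k" assume a: "a \<in> steinberg_carrier" and u: "u \<in> P"
    have "a \<star> u \<in> steinberg_carrier"
      using steinberg_convolution_isolated[OF a] u PF isolated_functions_subset by blast
    moreover have "gsource G c = x" if "(a \<star> u) c \<noteq> 0" for c
      using that u unfolding P by (elim convolution_supportE) auto
    ultimately show "a \<star> u \<in> P" unfolding P by blast
  qed
  moreover have "indicator {x} \<in> P"
    using e isolated_functions_subset x(1) unfolding P by (auto simp: indicator_def)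
  then have "P \<noteq> {0}" by (metis indicator_simps(1) singletonD singletonI zero_fun_apply zero_neq_one)
  moreover have "J = {0} \<or> J = P" if J: "left_ideal (steinberg_algebra G) J" "J \<subseteq> P" for J
  proof (cases "\<exists>u\<in>J. u \<noteq> 0")
    case False
    then show ?thesis using left_idealD(2)[OF J(1)] by blast
  next
    case True
    note Jd = left_idealD[OF J(1), unfolded amult_steinberg ascale_steinberg]
    obtain u c where u: "u \<in> J" and uc: "u c \<noteq> 0" using True by (metis ext zero_fun_apply)
    have "u \<in> P" using u J(2) by blast
    then have c: "c \<in> gcarrier G" "gsource G c = x" "openin (gtop G) {c}"
      using uc PF steinberg_outside[of u c] unfolding P by (auto simp: isolated_functions_def)
    have "openin (gtop G) {ginv G c}" using c x(2) isolated_range_iff[of "ginv G c"] by simp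
    then have "(indicator {ginv G c} :: 'g \<Rightarrow> 'k) \<in> steinberg_carrier"
      using indicator_isolated isolated_functions_subset by blast
    then have "(\<lambda>d. inverse (u c) * (indicator {ginv G c} \<star> u) d) \<in> J"
      using Jd(4,5) u by blast
    moreover have "(\<lambda>d. inverse (u c) * (indicator {ginv G c} \<star> u) d) = indicator {x}"
    proof
      fix d
      show "inverse (u c) * (indicator {ginv G c} \<star> u) d = indicator {x} d"
      proof (cases "d \<in> gcarrier G \<and> grange G d = x")
        case False
        then show ?thesis
          using c x(1) by (cases "d \<in> gcarrier G")
            (auto simp: convolution_outside convolution_point_mass_left indicator_def)
      next
        case d: True
        then have eq: "(indicator {ginv G c} \<star> u) d = u (c \<cdot> d)"
          using c by (simp add: convolution_point_mass_left)
        show ?thesis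
        proof (cases "u (c \<cdot> d) = 0")
          case True
          moreover have "d \<noteq> x" using True uc c by auto
          ultimately show ?thesis using eq by simp
        next
          case False
          then have "gsource G (c \<cdot> d) = x" using \<open>u \<in> P\<close> unfolding P by blast
          then have "d \<in> isotropy G x" using c d by (simp add: isotropy_def)
          then have "d = x" using iso by simp
          then show ?thesis using eq uc c mult_source_self[of c] by simp
        qed
      qed
    qed
    ultimately have "indicator {x} \<in> J" by simp
    then have "P \<subseteq> J" using Jd(5) unfolding P_def principal_left_def by auto
    then show ?thesis using J(2) by blast
  qed
  ultimately show ?thesis unfolding minimal_left_ideal_def by blast
qed

text \<open>Schur's lemma for right multiplication: a module homomorphism out of a minimal left ideal is zero
  or an isomorphism onto its image. That the image stays inside the algebra uses that \<open>I\<close>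
  consists of functions supported on finitely many isolated points.\<close>
lemma right_translate_minimal:
  assumes I: "minimal_left_ideal (steinberg_algebra G) I" and a: "a \<in> steinberg_carrier"
  shows "(\<forall>u\<in>I. u \<star> a = 0) \<or>
    left_ideal (steinberg_algebra G) ((\<lambda>u. u \<star> a) ` I) \<and>
    left_ideal_iso (steinberg_algebra G) ((\<lambda>u. u \<star> a) ` I) I"
proof (rule disjCI)
  note Id = left_idealD[OF minimal_left_idealD(1)[OF I], unfolded amult_steinberg ascale_steinberg]
  assume "\<not> (left_ideal (steinberg_algebra G) ((\<lambda>u. u \<star> a) ` I) \<and>
    left_ideal_iso (steinberg_algebra G) ((\<lambda>u. u \<star> a) ` I) I)"
  moreover have "left_ideal (steinberg_algebra G) ((\<lambda>u. u \<star> a) ` I) \<and>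
    left_ideal_iso (steinberg_algebra G) ((\<lambda>u. u \<star> a) ` I) I"
    if zero: "\<And>u. u \<in> I \<Longrightarrow> u \<star> a = 0 \<Longrightarrow> u = 0"
  proof
    have "u = v" if "u \<in> I" "v \<in> I" "u \<star> a = v \<star> a" for u v
    proof -
      \<comment> \<open>The difference is written as a sum with a scalar multiple, the operations an ideal is closed
        under.\<close>
      have "u + (\<lambda>c. - 1 * v c) \<in> I" using that Id(3,4) by blast
      moreover have "(u + (\<lambda>c. - 1 * v c)) \<star> a = 0"
        using that(3) by (simp only: convolution_distrib_right[OF a] convolution_scale_left[OF a])
          (simp add: fun_eq_iff)
      ultimately have "u + (\<lambda>c. - 1 * v c) = 0" using zero by blast
      then show ?thesis by (simp add: fun_eq_iff)
    qed
    then have inj: "inj_on (\<lambda>u. u \<star> a) I" by (auto intro: inj_onI)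
    have left: "left_ideal (steinberg_algebra G) ((\<lambda>u. u \<star> a) ` I)"
      unfolding left_ideal_def amult_steinberg ascale_steinberg
    proof (intro conjI ballI allI)
      show "(\<lambda>u. u \<star> a) ` I \<subseteq> steinberg_carrier"
        using isolated_convolution_steinberg[OF minimal_left_ideal_isolated[OF I] a]
          isolated_functions_subset by blast
      show "0 \<in> (\<lambda>u. u \<star> a) ` I" using Id(2) by (intro image_eqI[of _ _ 0]) auto
    qed (auto simp: convolution_distrib_right[OF a, symmetric]
        convolution_scale_left[OF a, symmetric] steinberg_assoc[OF _ a, symmetric] intro!: imageI Id(3-5))
    then show "left_ideal (steinberg_algebra G) ((\<lambda>u. u \<star> a) ` I)" .
    have "left_ideal_iso (steinberg_algebra G) I ((\<lambda>u. u \<star> a) ` I)"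
      unfolding left_ideal_iso_def amult_steinberg ascale_steinberg
      using inj a by (intro exI[of _ "\<lambda>u. u \<star> a"])
        (simp add: bij_betw_def convolution_distrib_right convolution_scale_left steinberg_assoc)
    then show "left_ideal_iso (steinberg_algebra G) ((\<lambda>u. u \<star> a) ` I) I"
      using left_ideal_iso_sym minimal_left_idealD(1)[OF I] by blast
  qed
  ultimately show "\<forall>u\<in>I. u \<star> a = 0"
    using right_mult_zero_or_injective[OF I a] by blast
qed

text \<open>A right translate of a member is zero or again a member. Closure under isomorphism is what the
  family of all minimal left ideals and the isomorphism class of one of them have in common.\<close>
lemma subspace_sum_two_sided:
  fixes \<I> :: "('g \<Rightarrow> 'k::field) set set"
  assumes min: "\<And>I. I \<in> \<I> \<Longrightarrow> minimal_left_ideal (steinberg_algebra G) I"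
    and iso: "\<And>I J. I \<in> \<I> \<Longrightarrow> left_ideal (steinberg_algebra G) J \<Longrightarrow>
      left_ideal_iso (steinberg_algebra G) J I \<Longrightarrow> J \<in> \<I>"
  shows "two_sided_ideal (steinberg_algebra G) (subspace_sum \<I>)"
proof -
  let ?A = "steinberg_algebra G"
  have left: "left_ideal ?A I" if "I \<in> \<I>" for I using min[OF that] minimal_left_idealD(1) by blast
  have add_closed: "u + v \<in> subspace_sum \<I>" if "u \<in> subspace_sum \<I>" "v \<in> subspace_sum \<I>" for u v
    by (rule subspace_sum_add[where A = ?A]) (rule left that; assumption?)+
  note sup = subspace_sum_superset[of _ \<I>, THEN subsetD]
  note Id = left_idealD[OF left, unfolded amult_steinberg ascale_steinberg]
  have closed: "\<phi> z \<in> subspace_sum \<I>"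
    if z: "z \<in> subspace_sum \<I>" and "\<phi> 0 = 0" "\<And>u v. \<phi> (u + v) = \<phi> u + \<phi> v"
      "\<And>I u. I \<in> \<I> \<Longrightarrow> u \<in> I \<Longrightarrow> \<phi> u \<in> subspace_sum \<I>" for \<phi> z
    using z
  proof (induction rule: subspace_sum_induct)
    case zero
    show ?case unfolding that(2) by (rule zero_in_subspace_sum)
  next
    case (add I u v)
    show ?case unfolding that(3) using that(4) add by (intro add_closed)
  qed
  have isolated: "z \<in> isolated_functions" if "z \<in> subspace_sum \<I>" for z
    using that
  proof (induction rule: subspace_sum_induct)
    case zero
    show ?case by (rule isolated_functions_zero)
  next
    case (add I u v)
    then show ?case using minimal_left_ideal_isolated[OF min] isolated_functions_add by blast
  qed
  show ?thesis
    unfolding two_sided_ideal_def left_ideal_def amult_steinberg ascale_steinberg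
  proof (intro conjI ballI allI)
    show "subspace_sum \<I> \<subseteq> steinberg_carrier" using isolated isolated_functions_subset by blast
    show "0 \<in> subspace_sum \<I>" by (rule zero_in_subspace_sum)
  next
    fix u v assume "u \<in> subspace_sum \<I>" "v \<in> subspace_sum \<I>"
    then show "u + v \<in> subspace_sum \<I>" by (rule add_closed)
  next
    fix k z assume "z \<in> subspace_sum \<I>"
    then show "(\<lambda>c. k * z c) \<in> subspace_sum \<I>"
      by (rule closed[of _ "\<lambda>z c. k * z c"])
        (auto simp: fun_eq_iff distrib_left intro: sup Id(4))
  next
    fix a z :: "'g \<Rightarrow> 'k" assume a: "a \<in> steinberg_carrier" and "z \<in> subspace_sum \<I>"
    from this(2) show "a \<star> z \<in> subspace_sum \<I>"
      by (rule closed[of _ "\<lambda>z. a \<star> z"])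
        (auto simp: convolution_distrib_left[OF a] intro: sup Id(5)[OF _ a])
  next
    fix a z :: "'g \<Rightarrow> 'k" assume a: "a \<in> steinberg_carrier" and "z \<in> subspace_sum \<I>"
    from this(2) show "z \<star> a \<in> subspace_sum \<I>"
    proof (rule closed[of _ "\<lambda>z. z \<star> a"])
      fix I u assume I: "I \<in> \<I>" "u \<in> I"
      show "u \<star> a \<in> subspace_sum \<I>"
        using right_translate_minimal[OF min[OF I(1)] a]
      proof
        assume *: "left_ideal ?A ((\<lambda>u. u \<star> a) ` I) \<and> left_ideal_iso ?A ((\<lambda>u. u \<star> a) ` I) I"
        then show ?thesis using sup[OF iso[OF I(1)]] I(2) by blast
      next
        assume "\<forall>u\<in>I. u \<star> a = 0"
        then show ?thesis using I(2) zero_in_subspace_sum[of \<I>] by simp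
      qed
    qed (simp_all add: convolution_distrib_right[OF a])
  qed
qed

end

theorem theorem4p2:
  fixes G :: "'g groupoid_data"
    and A :: "('k::field, 'g \<Rightarrow> 'k) algebra_data"
  assumes ample: "ample_groupoid G"
    and hausdorff: "Hausdorff_space (gtop G)"
    and isotropy_socle: "\<forall>x \<in> unit_space G.
      socle (steinberg_algebra (isotropy_group G x) :: ('k, 'g \<Rightarrow> 'k) algebra_data) \<noteq> {0}
        \<longleftrightarrow> isotropy G x = {x}"
    and A: "A = steinberg_algebra G"
  shows "socle A = ideal_generated A
           {indicator {x} | x. x \<in> unit_space G \<and> openin (gtop G) {x} \<and> isotropy G x = {x}} \<and>
         (\<forall>x \<in> unit_space G. openin (gtop G) {x} \<and>
           minimal_left_ideal A (principal_left A (indicator {x})) \<longrightarrow>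
           homogeneous_component A (principal_left A (indicator {x}))
             = ideal_generated A {indicator {x}})"
proof -
  interpret ample_hausdorff_groupoid G
    by unfold_locales (rule ample hausdorff)+
  have in_principal: "(indicator {x} :: 'g \<Rightarrow> 'k) \<in> principal_left A (indicator {x})"
    if "x \<in> unit_space G" "openin (gtop G) {x}" for x
    using that indicator_isolated isolated_functions_subset unfolding A principal_left_unit[OF that]
    by (auto simp: indicator_def)
  show ?thesis
  proof (intro conjI ballI impI)
    let ?S = "{indicator {x} | x. x \<in> unit_space G \<and> openin (gtop G) {x} \<and> isotropy G x = {x}} :: ('g \<Rightarrow> 'k) set"
    have "two_sided_ideal A hull ?S = socle A"
    proof (rule hull_unique)
      show "?S \<subseteq> socle A"
      proof
        fix e assume "e \<in> ?S"
        then obtain x where x: "e = indicator {x}" "x \<in> unit_space G" "openin (gtop G) {x}"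
          "isotropy G x = {x}" by blast
        then have "minimal_left_ideal A (principal_left A (indicator {x}))"
          using principal_left_unit_minimal unfolding A by blast
        then have "principal_left A (indicator {x}) \<subseteq> socle A"
          unfolding socle_def by (intro subspace_sum_superset) simp
        then show "e \<in> socle A" using in_principal x by blast
      qed
      show "two_sided_ideal A (socle A)"
        unfolding socle_def A by (rule subspace_sum_two_sided) (auto intro: minimal_left_ideal_iso)
    next
      fix T assume T: "?S \<subseteq> T" "two_sided_ideal A T"
      show "socle A \<subseteq> T"
        unfolding socle_def
      proof (rule subspace_sum_subset_left_ideal)
        show "left_ideal A T" using T(2) by (simp add: two_sided_ideal_def)
        fix I assume "I \<in> {I. minimal_left_ideal A I}"
        then have I: "minimal_left_ideal (steinberg_algebra G) I" by (simp add: A)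
        show "I \<subseteq> T"
        proof
          fix f assume f: "f \<in> I"
          show "f \<in> T"
          proof (rule two_sided_ideal_localise)
            show "two_sided_ideal (steinberg_algebra G) T" using T(2) A by simp
            show fF: "f \<in> isolated_functions" by (rule minimal_left_ideal_isolated[OF I f])
            fix c assume c: "f c \<noteq> 0"
            have "c \<in> gcarrier G"
              using c fF isolated_functions_subset steinberg_outside by blast
            then have unit: "gsource G c \<in> unit_space G" by simp
            then have "isotropy G (gsource G c) = {gsource G c}"
              using isotropy_socle source_of_minimal_left_ideal(2)[OF I f c] by blast
            then have "indicator {gsource G c} \<in> ?S"
              using unit source_of_minimal_left_ideal(1)[OF I f c] by blast
            then show "indicator {gsource G c} \<in> T" using T(1) by blast
          qed
        qed
      qed
    qed
    then show "socle A = ideal_generated A ?S" by (simp add: ideal_generated_def)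
  next
    fix x assume x: "x \<in> unit_space G"
      and "openin (gtop G) {x} \<and> minimal_left_ideal A (principal_left A (indicator {x}))"
    then have op: "openin (gtop G) {x}"
      and min: "minimal_left_ideal A (principal_left A (indicator {x}))" by auto
    let ?e = "indicator {x} :: 'g \<Rightarrow> 'k"
    let ?P = "principal_left A ?e"
    have "two_sided_ideal A hull {?e} = homogeneous_component A ?P"
    proof (rule hull_unique)
      have "left_ideal_iso A ?P ?P"
        unfolding left_ideal_iso_def by (intro exI[of _ id]) simp
      then have "?P \<subseteq> homogeneous_component A ?P"
        using minimal_left_idealD(1)[OF min] unfolding homogeneous_component_def
        by (intro subspace_sum_superset) simp
      then show "{?e} \<subseteq> homogeneous_component A ?P" using in_principal[OF x op] by blast
      show "two_sided_ideal A (homogeneous_component A ?P)"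
        using min unfolding homogeneous_component_def A
        by (intro subspace_sum_two_sided)
          (auto intro: minimal_left_ideal_iso left_ideal_iso_trans)
    next
      fix T assume T: "{?e} \<subseteq> T" "two_sided_ideal A T"
      show "homogeneous_component A ?P \<subseteq> T"
        unfolding homogeneous_component_def
      proof (rule subspace_sum_subset_left_ideal)
        show "left_ideal A T" using T(2) by (simp add: two_sided_ideal_def)
        fix J assume "J \<in> {J. left_ideal A J \<and> left_ideal_iso A J ?P}"
        then have J: "left_ideal A J" "left_ideal_iso A ?P J"
          using left_ideal_iso_sym by auto
        obtain \<phi> where bij: "bij_betw \<phi> ?P J"
          and \<phi>: "\<And>a u. a \<in> acarrier A \<Longrightarrow> u \<in> ?P \<Longrightarrow> \<phi> (amult A a u) = amult A a (\<phi> u)"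
          using J(2) unfolding left_ideal_iso_def by blast
        have eA: "?e \<in> acarrier A"
          using indicator_isolated[OF op] isolated_functions_subset unfolding A by blast
        have eP: "?e \<in> ?P" by (rule in_principal[OF x op])
        have \<phi>e: "\<phi> ?e \<in> acarrier A" using bij_betw_apply[OF bij eP] left_idealD(1)[OF J(1)] by blast
        have "\<phi> ?e = amult A ?e (\<phi> ?e)"
          using \<phi>[OF eA eP] by (simp add: A indicator_unit_idem[OF x])
        moreover have "amult A ?e (\<phi> ?e) \<in> T"
          using T \<phi>e unfolding two_sided_ideal_def by blast
        ultimately have \<phi>T: "\<phi> ?e \<in> T" by simp
        show "J \<subseteq> T"
        proof
          fix u assume "u \<in> J"
          then obtain v where "v \<in> ?P" "u = \<phi> v" using bij by (auto simp: bij_betw_def)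
          then obtain a where a: "a \<in> acarrier A" "u = \<phi> (amult A a ?e)"
            by (auto simp: principal_left_def)
          then show "u \<in> T"
            using \<phi>[OF a(1) eP] \<phi>T T(2) unfolding two_sided_ideal_def left_ideal_def by simp
        qed
      qed
    qed
    then show "homogeneous_component A ?P = ideal_generated A {?e}"
      by (simp add: ideal_generated_def)
  qed
qed

end
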